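(* Let $0\le p\le 1$ and $1<\alpha<2$, and let $\mu,\nu$ be real numbers with $\alpha-2\le\mu,\nu\le 0$ satisfying $$\mu+\nu=\alpha-2,\qquad p\sin(\pi\mu)=(1-p)\sin(\pi\nu).$$ Then for $x\in(-1,1)$ and every $n=0,1,2,\ldots$, $$\mathcal{I}_{p,-1,1}^{\mu,\nu,2-\alpha}J_{n}^{-\mu,-\nu}(x)=\lambda_{n}P_{n}^{\nu,\mu}(x),\qquad \lambda_{n}=\frac{\Gamma(n+\alpha-1)}{\Gamma(n+1)},$$ and for every integer $k\ge 1$, $$\mathcal{D}_{p,-1,1}^{\mu,\nu,k+\alpha-2}J_{n}^{-\mu,-\nu}(x)=\tilde{C}_{\alpha}P_{n-k}^{\nu+k,\mu+k}(x),\qquad \tilde{C}_{\alpha}=\frac{\Gamma(n+k+\alpha-1)}{2^k\Gamma(n+1)}.$$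
   Context: $P_n^{a,b}$ is the classical Jacobi polynomial of degree $n$ (with the convention $P_m^{a,b}\equiv 0$ for $m<0$). The Jacobi poly-fractonomials are $J_n^{-\mu,-\nu}(x):=(1-x)^{\mu}(1+x)^{\nu}P_n^{\mu,\nu}(x)$, $x\in(-1,1)$. For $\sigma>0$, ${}_{-1}I_x^{\sigma}v(x)=\frac{1}{\Gamma(\sigma)}\int_{-1}^x (x-y)^{\sigma-1}v(y)\,dy$ and ${}_{x}I_1^{\sigma}v(x)=\frac{1}{\Gamma(\sigma)}\int_x^1 (y-x)^{\sigma-1}v(y)\,dy$. With $C_{\alpha,p}:=(\sin\pi\mu+\sin\pi\nu)/\sin\pi\alpha$, the two-sided fractional integral is $\mathcal{I}_{p,-1,1}^{\mu,\nu,\varrho}v:=C_{\alpha,p}\big(p\,{}_{-1}I_x^{\varrho}v+(1-p)\,{}_{x}I_1^{\varrho}v\big)$, and for $q\in(k-1,k)$, $k\in\mathbb{N}$, the two-sided Riemann–Liouville derivative is $\mathcal{D}_{p,-1,1}^{\mu,\nu,q}v:=\frac{d^k}{dx^k}\mathcal{I}_{p,-1,1}^{\mu,\nu,k-q}v$. *)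

theory Defs
  imports "HOL-Analysis.Analysis"
begin

definition jacobiP :: "int \<Rightarrow> real \<Rightarrow> real \<Rightarrow> real \<Rightarrow> real" where
  "jacobiP n a b x =
     (if n < 0 then 0
      else (\<Sum>s=0..nat n. ((real (nat n) + a) gchoose (nat n - s)) * ((real (nat n) + b) gchoose s)
                          * ((x - 1) / 2) ^ s * ((x + 1) / 2) ^ (nat n - s)))"

text \<open>Jacobi poly-fractonomial J_n^{-mu,-nu}(x) = (1-x)^mu (1+x)^nu P_n^{mu,nu}(x), x in (-1,1).\<close>
definition polyfrac :: "nat \<Rightarrow> real \<Rightarrow> real \<Rightarrow> real \<Rightarrow> real" where
  "polyfrac n \<mu> \<nu> x = (1 - x) powr \<mu> * (1 + x) powr \<nu> * jacobiP (int n) \<mu> \<nu> x"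

definition left_RL_int :: "real \<Rightarrow> (real \<Rightarrow> real) \<Rightarrow> real \<Rightarrow> real" where
  "left_RL_int \<sigma> v x = (1 / Gamma \<sigma>) * integral {-1..x} (\<lambda>y. (x - y) powr (\<sigma> - 1) * v y)"

definition right_RL_int :: "real \<Rightarrow> (real \<Rightarrow> real) \<Rightarrow> real \<Rightarrow> real" where
  "right_RL_int \<sigma> v x = (1 / Gamma \<sigma>) * integral {x..1} (\<lambda>y. (y - x) powr (\<sigma> - 1) * v y)"

definition C_const :: "real \<Rightarrow> real \<Rightarrow> real \<Rightarrow> real" where
  "C_const \<alpha> \<mu> \<nu> = (sin (pi * \<mu>) + sin (pi * \<nu>)) / sin (pi * \<alpha>)"

definition two_sided_int :: "real \<Rightarrow> real \<Rightarrow> real \<Rightarrow> real \<Rightarrow> real \<Rightarrow> (real \<Rightarrow> real) \<Rightarrow> real \<Rightarrow> real" where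
  "two_sided_int p \<alpha> \<mu> \<nu> \<rho> v x =
     C_const \<alpha> \<mu> \<nu> * (p * left_RL_int \<rho> v x + (1 - p) * right_RL_int \<rho> v x)"

definition two_sided_deriv :: "real \<Rightarrow> real \<Rightarrow> real \<Rightarrow> real \<Rightarrow> real \<Rightarrow> (real \<Rightarrow> real) \<Rightarrow> real \<Rightarrow> real" where
  "two_sided_deriv p \<alpha> \<mu> \<nu> q v x =
     (let k = nat \<lceil>q\<rceil> in (deriv ^^ k) (two_sided_int p \<alpha> \<mu> \<nu> (real k - q) v) x)"

end

theory Submission
  imports Defs
begin

text \<open>
  Put \<open>a = -\<mu>\<close>, \<open>b = -\<nu>\<close>, \<open>y = 2u - 1\<close> and \<open>x = 2t - 1\<close>. Up to a constant, the two-sided integral of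
  \<open>(1-y)\<^sup>\<mu> (1+y)\<^sup>\<nu> q(y)\<close> is then the functional
  \<open>M q = sin(\<pi>b) \<integral>\<^sub>0\<^sup>t (t-u)\<^bsup>a+b-1\<^esup> u\<^bsup>-b\<^esup> (1-u)\<^bsup>-a\<^esup> q du + sin(\<pi>a) \<integral>\<^sub>t\<^sup>1 (u-t)\<^bsup>a+b-1\<^esup> u\<^bsup>-b\<^esup> (1-u)\<^bsup>-a\<^esup> q du\<close>.

  Expanding \<open>(1-u)\<^bsup>-a\<^esup>\<close> in the binomial series turns the left integrals of \<open>1\<close> and \<open>u\<close> into incomplete Beta
  integrals over \<open>[0,t]\<close>, and reflection turns the right ones into the same integrals over \<open>[t,1]\<close>. The
  sine weights make the two prefactors equal, so only complete Beta integrals remain and \<open>M 1\<close>, \<open>M u\<close>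
  are polynomials in \<open>t\<close>. Integrating the derivative of \<open>|t-u|\<^bsup>a+b\<^esup> u\<^bsup>j+1-b\<^esup> (1-u)\<^bsup>1-a\<^esup>\<close> gives a three-term
  recurrence for \<open>M u\<^sup>j\<close>. It is the one satisfied by the coefficients of \<open>(1-tz)\<^bsup>a+b-1\<^esup> (1-z)\<^bsup>-a\<^esup>\<close>, so
  \<open>M u\<^sup>j\<close> is \<open>\<pi>\<close> times the \<open>j\<close>-th coefficient. Vandermonde's identity then sums these
  moments to the Jacobi polynomial with exchanged parameters, and the derivative statement follows
  from \<open>d/dx P\<^sub>n\<^bsup>c,d\<^esup> = (n+c+d+1)/2 P\<^bsub>n-1\<^esub>\<^bsup>c+1,d+1\<^esup>\<close>.
\<close>

section \<open>Jacobi polynomials\<close>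

text \<open>Both sides equal \<open>(r gchoose (m + k))\<close> times the ordinary binomial
  coefficient of \<open>m + k\<close> over \<open>k\<close>, which is symmetric in \<open>m\<close>
  and \<open>k\<close>.\<close>

lemma gbinomial_mult_swap:
  fixes r :: "'a::field_char_0"
  shows "(r gchoose m) * (r - of_nat m gchoose k) = (r gchoose k) * (r - of_nat k gchoose m)"
proof -
  have "(r gchoose (m + k)) * (of_nat (m + k) gchoose k) = (r gchoose k) * (r - of_nat k gchoose m)"
    using gbinomial_trinomial_revision[of k "m + k" r] by simp
  moreover have "(r gchoose (m + k)) * (of_nat (m + k) gchoose m) = (r gchoose m) * (r - of_nat m gchoose k)"
    using gbinomial_trinomial_revision[of m "m + k" r] by simp
  moreover have "(of_nat (m + k) gchoose k :: 'a) = (of_nat (m + k) gchoose m)"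
    using binomial_symmetric[of k "m + k"] by (simp add: binomial_gbinomial [symmetric] del: of_nat_add)
  ultimately show ?thesis by simp
qed

lemma jacobiP_nat:
  "jacobiP (int n) a b (2 * t - 1) =
     (\<Sum>s\<le>n. (real n + a gchoose (n - s)) * (real n + b gchoose s) * (t - 1) ^ s * t ^ (n - s))"
proof -
  have "(2 * t - 1 - 1) / 2 = t - 1" "(2 * t - 1 + 1) / 2 = t" by (simp_all add: field_simps)
  thus ?thesis unfolding jacobiP_def by (simp only:) (simp add: atMost_atLeast0)
qed

text \<open>Expand \<open>(t - 1) ^ s\<close> binomially and collect equal powers of
  \<open>t\<close>. Trinomial revision pulls \<open>real n + b gchoose l\<close> out of the sum over
  \<open>s\<close>, and Vandermonde sums what is left. In this form differentiation and the
  comparison with moments can be done coefficient by coefficient.\<close>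

lemma jacobiP_monomials:
  "jacobiP (int n) a b (2 * t - 1) =
     (\<Sum>l\<le>n. (- 1) ^ l * (real n + b gchoose l) * (2 * real n - real l + a + b gchoose (n - l)) * t ^ (n - l))"
proof -
  let ?A = "real n + a" and ?B = "real n + b"
  have "jacobiP (int n) a b (2 * t - 1) =
    (\<Sum>s\<le>n. \<Sum>l\<le>s. (?A gchoose (n - s)) * (?B gchoose s) * (real (s choose l) * (-1) ^ l * t ^ (n - l)))"
    unfolding jacobiP_nat
  proof (rule sum.cong[OF refl])
    fix s assume s: "s \<in> {..n}"
    have "(t - 1) ^ s * t ^ (n - s) = (\<Sum>l\<le>s. real (s choose l) * (-1) ^ l * t ^ (s - l) * t ^ (n - s))"
      using binomial_ring[of "-1::real" t s] by (simp add: sum_distrib_right add.commute)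
    also have "\<dots> = (\<Sum>l\<le>s. real (s choose l) * (-1) ^ l * t ^ (n - l))"
      using s by (intro sum.cong) (auto simp flip: power_add)
    finally show "(?A gchoose (n - s)) * (?B gchoose s) * (t - 1) ^ s * t ^ (n - s) =
      (\<Sum>l\<le>s. (?A gchoose (n - s)) * (?B gchoose s) * (real (s choose l) * (-1) ^ l * t ^ (n - l)))"
      by (simp add: sum_distrib_left mult.assoc)
  qed
  also have "\<dots> = (\<Sum>l\<le>n. \<Sum>s\<in>{l..n}. (?A gchoose (n - s)) * (?B gchoose s) * (real (s choose l) * (-1) ^ l * t ^ (n - l)))"
  proof -
    have "{..s} = {l \<in> {..n}. l \<le> s}" if "s \<in> {..n}" for s using that by auto
    hence 1: "(\<Sum>s\<le>n. \<Sum>l\<le>s. f s l) = (\<Sum>s\<le>n. \<Sum>l\<in>{l \<in> {..n}. l \<le> s}. f s l)" for f :: "nat \<Rightarrow> nat \<Rightarrow> real"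
      by (intro sum.cong) auto
    have 2: "{l..n} = {s \<in> {..n}. l \<le> s}" for l by auto
    show ?thesis unfolding 1 2 by (rule sum.swap_restrict) auto
  qed
  also have "\<dots> = (\<Sum>l\<le>n. (- 1) ^ l * (?B gchoose l) * (2 * real n - real l + a + b gchoose (n - l)) * t ^ (n - l))"
  proof (rule sum.cong[OF refl])
    fix l assume l: "l \<in> {..n}"
    have "(\<Sum>s\<in>{l..n}. (?A gchoose (n - s)) * (?B gchoose s) * (real (s choose l) * (-1) ^ l * t ^ (n - l)))
      = (\<Sum>s\<in>{l..n}. ((-1) ^ l * (?B gchoose l) * t ^ (n - l)) * ((?B - real l gchoose (s - l)) * (?A gchoose (n - s))))"
    proof (rule sum.cong[OF refl])
      fix s assume "s \<in> {l..n}"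
      hence eq: "(?B gchoose s) * real (s choose l) = (?B gchoose l) * (?B - real l gchoose (s - l))"
        using gbinomial_trinomial_revision[of l s ?B] by (simp add: binomial_gbinomial)
      have "(?A gchoose (n - s)) * (?B gchoose s) * (real (s choose l) * (-1) ^ l * t ^ (n - l)) =
          (-1) ^ l * t ^ (n - l) * (?A gchoose (n - s)) * ((?B gchoose s) * real (s choose l))"
        by (simp only: mult_ac)
      thus "(?A gchoose (n - s)) * (?B gchoose s) * (real (s choose l) * (-1) ^ l * t ^ (n - l))
        = ((-1) ^ l * (?B gchoose l) * t ^ (n - l)) * ((?B - real l gchoose (s - l)) * (?A gchoose (n - s)))"
        unfolding eq by (simp only: mult_ac)
    qed
    also have "\<dots> = ((-1) ^ l * (?B gchoose l) * t ^ (n - l)) *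
        (\<Sum>s\<in>{l..n}. (?B - real l gchoose (s - l)) * (?A gchoose (n - s)))"
      by (simp add: sum_distrib_left)
    also have "(\<Sum>s\<in>{l..n}. (?B - real l gchoose (s - l)) * (?A gchoose (n - s))) =
        (\<Sum>k\<le>n - l. (?B - real l gchoose k) * (?A gchoose (n - l - k)))"
      using l by (intro sum.reindex_bij_witness[of _ "\<lambda>k. k + l" "\<lambda>s. s - l"]) auto
    also have "\<dots> = (?B - real l + ?A gchoose (n - l))"
      using gbinomial_Vandermonde[of "?B - real l" ?A "n - l"] by (simp add: atMost_atLeast0)
    also have "?B - real l + ?A = 2 * real n - real l + a + b" by simp
    finally show "(\<Sum>s\<in>{l..n}. (?A gchoose (n - s)) * (?B gchoose s) * (real (s choose l) * (-1) ^ l * t ^ (n - l)))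
      = (- 1) ^ l * (?B gchoose l) * (2 * real n - real l + a + b gchoose (n - l)) * t ^ (n - l)"
      by (simp add: mult_ac)
  qed
  finally show ?thesis .
qed

text \<open>Termwise differentiation of the monomial form. The exponent \<open>n - l\<close> is
  absorbed into the second binomial coefficient, and the factor this releases,
  \<open>real n + a + b + 1\<close>, is the same for all \<open>l\<close>.\<close>

lemma jacobiP_has_field_derivative:
  "(jacobiP (int n) a b has_field_derivative
      (real n + a + b + 1) / 2 * jacobiP (int n - 1) (a + 1) (b + 1) x) (at x)"
proof (cases n)
  \<comment> \<open>Degree 0 gives a constant; the right-hand side is 0 by the convention for
    negative degree.\<close>
  case 0
  have "jacobiP (int n) a b = (\<lambda>_. 1)" by (simp add: jacobiP_def 0 fun_eq_iff)
  thus ?thesis by (simp add: 0 jacobiP_def)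
next
  case (Suc m)
  have half: "2 * ((x + 1) / 2) - 1 = x" for x :: real by (simp add: field_simps)
  let ?c = "\<lambda>l. (- 1) ^ l * (real n + b gchoose l) * (2 * real n - real l + a + b gchoose (n - l))"
  have eq: "jacobiP (int n) a b = (\<lambda>x. \<Sum>l\<le>n. ?c l * ((x + 1) / 2) ^ (n - l))"
  proof
    fix x show "jacobiP (int n) a b x = (\<Sum>l\<le>n. ?c l * ((x + 1) / 2) ^ (n - l))"
      using jacobiP_monomials[of n a b "(x + 1) / 2"] unfolding half .
  qed
  have "((\<lambda>x. \<Sum>l\<le>n. ?c l * ((x + 1) / 2) ^ (n - l)) has_field_derivative
          (\<Sum>l\<le>n. ?c l * (real (n - l) * ((x + 1) / 2) ^ (n - l - 1) * (1 / 2)))) (at x)"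
    by (auto intro!: derivative_eq_intros sum.cong)
  \<comment> \<open>The term \<open>l = n\<close> carries the factor
    \<open>real (n - l) = 0\<close>, so the sum ends at \<open>m = n - 1\<close>, the degree of the
    derivative.\<close>
  also have "(\<Sum>l\<le>n. ?c l * (real (n - l) * ((x + 1) / 2) ^ (n - l - 1) * (1 / 2))) =
     (\<Sum>l\<le>m. ?c l * (real (n - l) * ((x + 1) / 2) ^ (n - l - 1) * (1 / 2)))"
    by (simp add: Suc)
  also have "\<dots> = (real n + a + b + 1) / 2 * (\<Sum>l\<le>m. (- 1) ^ l * (real m + (b + 1) gchoose l) *
      (2 * real m - real l + (a + 1) + (b + 1) gchoose (m - l)) * ((x + 1) / 2) ^ (m - l))"
    unfolding sum_distrib_left
  proof (rule sum.cong[OF refl])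
    fix l assume l: "l \<in> {..m}"
    let ?N = "2 * real n - real l + a + b"
    have "real (Suc (m - l)) * (?N gchoose Suc (m - l)) = (?N - real (m - l)) * (?N gchoose (m - l))"
      using gbinomial_absorption[of "m - l" ?N] gbinomial_absorb_comp[of ?N "m - l"] by simp
    moreover have "n - l = Suc (m - l)" "?N - real (m - l) = real n + a + b + 1"
      using l by (auto simp: Suc of_nat_diff)
    ultimately have absorb: "real (n - l) * (?N gchoose (n - l)) = (real n + a + b + 1) * (?N gchoose (m - l))"
      by simp
    have eqs: "real m + (b + 1) = real n + b" "2 * real m - real l + (a + 1) + (b + 1) = ?N"
      "n - l - 1 = m - l"
      by (auto simp: Suc)
    have "?c l * (real (n - l) * ((x + 1) / 2) ^ (n - l - 1) * (1 / 2)) =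
      (- 1) ^ l * (real n + b gchoose l) * (real (n - l) * (?N gchoose (n - l))) * ((x + 1) / 2) ^ (m - l) / 2"
      using eqs(3) by (simp add: mult_ac)
    thus "?c l * (real (n - l) * ((x + 1) / 2) ^ (n - l - 1) * (1 / 2)) =
      (real n + a + b + 1) / 2 * ((- 1) ^ l * (real m + (b + 1) gchoose l) *
      (2 * real m - real l + (a + 1) + (b + 1) gchoose (m - l)) * ((x + 1) / 2) ^ (m - l))"
      unfolding absorb eqs by (simp add: mult_ac)
  qed
  also have "\<dots> = (real n + a + b + 1) / 2 * jacobiP (int m) (a + 1) (b + 1) x"
    using jacobiP_monomials[of m "a + 1" "b + 1" "(x + 1) / 2"] unfolding half by (simp only:)
  finally show ?thesis unfolding eq by (simp add: Suc)
qed

text \<open>At stage \<open>k\<close> the degree is \<open>n - k\<close> and the parameters are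
  \<open>a + k\<close> and \<open>b + k\<close>, so the next derivative brings
  \<open>(n + k + a + b + 1) / 2\<close>. The functional equation of Gamma absorbs the numerator,
  positivity keeping the argument away from the poles. Past the degree everything is 0.\<close>

lemma higher_deriv_jacobiP:
  assumes "open S" "\<And>x. x \<in> S \<Longrightarrow> f x = Gamma (real n + a + b + 1) * c * jacobiP (int n) a b x"
    and "real n + a + b + 1 > 0" and "x \<in> S"
  shows "(deriv ^^ k) f x =
    Gamma (real n + real k + a + b + 1) / 2 ^ k * c * jacobiP (int n - int k) (a + real k) (b + real k) x"
  using \<open>x \<in> S\<close>
proof (induction k arbitrary: x)
  case 0
  thus ?case using assms by simp
next
  case (Suc k)
  let ?G = "Gamma (real n + real k + a + b + 1) / 2 ^ k * c"
  have pos: "real n + real k + a + b + 1 > 0" using assms(3) by simp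
  have "((\<lambda>x. ?G * jacobiP (int n - int k) (a + real k) (b + real k) x) has_field_derivative
     Gamma (real n + real (Suc k) + a + b + 1) / 2 ^ Suc k * c *
       jacobiP (int n - int (Suc k)) (a + real (Suc k)) (b + real (Suc k)) x) (at x)"
  proof (cases "k \<le> n")
    case True
    have "(jacobiP (int (n - k)) (a + real k) (b + real k) has_field_derivative
       (real (n - k) + (a + real k) + (b + real k) + 1) / 2 *
       jacobiP (int (n - k) - 1) (a + real k + 1) (b + real k + 1) x) (at x)"
      by (rule jacobiP_has_field_derivative)
    moreover have "int (n - k) = int n - int k" "real (n - k) = real n - real k"
      using True by auto
    ultimately have "(jacobiP (int n - int k) (a + real k) (b + real k) has_field_derivative
       (real n + real k + a + b + 1) / 2 *
       jacobiP (int n - int (Suc k)) (a + real (Suc k)) (b + real (Suc k)) x) (at x)"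
      by (simp add: algebra_simps)
    from DERIV_cmult[OF this, of ?G] show ?thesis
    proof (rule DERIV_cong)
      have "real n + real k + a + b + 1 \<notin> \<int>\<^sub>\<le>\<^sub>0"
        using pos by (auto elim!: nonpos_Ints_cases)
      hence "Gamma (real n + real (Suc k) + a + b + 1) =
          (real n + real k + a + b + 1) * Gamma (real n + real k + a + b + 1)"
        using Gamma_plus1[of "real n + real k + a + b + 1"] by (simp add: add_ac)
      thus "?G * ((real n + real k + a + b + 1) / 2 *
          jacobiP (int n - int (Suc k)) (a + real (Suc k)) (b + real (Suc k)) x) =
        Gamma (real n + real (Suc k) + a + b + 1) / 2 ^ Suc k * c *
          jacobiP (int n - int (Suc k)) (a + real (Suc k)) (b + real (Suc k)) x"
        by (simp only:) (simp add: mult_ac)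
    qed
  next
    case False
    hence "int n - int k < 0" "int n - int (Suc k) < 0" by auto
    thus ?thesis by (simp add: jacobiP_def)
  qed
  \<comment> \<open>A derivative depends only on values near \<open>x\<close>, so the induction
    hypothesis on the open set \<open>S\<close> suffices.\<close>
  moreover have "eventually (\<lambda>y. (deriv ^^ k) f y =
      ?G * jacobiP (int n - int k) (a + real k) (b + real k) y) (nhds x)"
    using eventually_nhds_in_open[OF \<open>open S\<close> \<open>x \<in> S\<close>] by eventually_elim (rule Suc.IH)
  ultimately show ?case
    by (simp add: deriv_cong_ev[OF _ refl] DERIV_imp_deriv)
qed

section \<open>Moments of the fractional kernel\<close>

lemma integrable_mult_continuous:
  fixes f g :: "real \<Rightarrow> real"
  assumes "f integrable_on {c..d}" "\<And>u. u \<in> {c..d} \<Longrightarrow> 0 \<le> f u" "continuous_on {c..d} g"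
  shows "(\<lambda>u. f u * g u) integrable_on {c..d}"
proof -
  have "(\<lambda>u. g u * f u) absolutely_integrable_on {c..d}"
    using assms by (intro absolutely_integrable_bounded_measurable_product_real
      nonnegative_absolutely_integrable_1 continuous_imp_measurable_on_sets_lebesgue
      compact_imp_bounded compact_continuous_image) auto
  thus ?thesis
    using set_lebesgue_integral_eq_integral(1) by (simp add: mult.commute)
qed

text \<open>Since the terms are nonnegative, the limit \<open>F\<close> itself dominates all partial
  sums, and dominated convergence applies.\<close>

lemma nonneg_sums_integral:
  fixes f :: "nat \<Rightarrow> real \<Rightarrow> real"
  assumes f: "\<And>k. (f k has_integral I k) S" and nonneg: "\<And>k u. u \<in> S \<Longrightarrow> 0 \<le> f k u"
    and sums: "\<And>u. u \<in> S \<Longrightarrow> (\<lambda>k. f k u) sums F u" and F: "F integrable_on S"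
  shows "I sums integral S F"
proof -
  have *: "((\<lambda>u. \<Sum>k<n. f k u) has_integral (\<Sum>k<n. I k)) S" for n
    by (intro has_integral_sum f) auto
  have "(\<lambda>n. integral S (\<lambda>u. \<Sum>k<n. f k u)) \<longlonglongrightarrow> integral S F"
  proof (rule dominated_convergence(2)[OF _ F])
    show "(\<lambda>u. \<Sum>k<n. f k u) integrable_on S" for n using * by blast
    show "norm (\<Sum>k<n. f k u) \<le> F u" if "u \<in> S" for n u
    proof -
      have "summable (\<lambda>k. f k u)" "(\<Sum>k. f k u) = F u" using sums[OF that] by (auto simp: sums_iff)
      thus ?thesis using nonneg[OF that] sum_le_suminf[of "\<lambda>k. f k u" "{..<n}"] by (simp add: sum_nonneg)
    qed
    show "(\<lambda>n. \<Sum>k<n. f k u) \<longlonglongrightarrow> F u" if "u \<in> S" for u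
      using sums[OF that] by (simp add: sums_def)
  qed
  moreover have "integral S (\<lambda>u. \<Sum>k<n. f k u) = (\<Sum>k<n. I k)" for n
    using * by (rule integral_unique)
  ultimately show ?thesis by (simp add: sums_def)
qed

lemma one_minus_powr_sums:
  assumes "\<bar>u\<bar> < (1::real)"
  shows "(\<lambda>k. pochhammer c k / fact k * u ^ k) sums (1 - u) powr (- c)"
proof -
  have "(- c gchoose k) * (- u) ^ k = pochhammer c k / fact k * u ^ k" for k
    by (simp add: gbinomial_pochhammer power_mult_distrib [symmetric] flip: power_minus)
  thus ?thesis using gen_binomial_real[of "- u" "- c"] assms by simp
qed

lemma has_integral_Beta_scaled:
  fixes x y t :: real
  assumes "x > 0" "y > 0" "t > 0"
  shows "((\<lambda>u. u powr (x - 1) * (t - u) powr (y - 1)) has_integral t powr (x + y - 1) * Beta x y) {0..t}"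
proof -
  have "((\<lambda>u. (1 / t * u) powr (x - 1) * (1 - 1 / t * u) powr (y - 1)) has_integral t * Beta x y)
     ((\<lambda>u. u / (1 / t)) ` {0..1})"
    using has_integral_stretch_real[OF has_integral_Beta_real[OF assms(1,2)], of "1 / t"] assms by simp
  also have "(\<lambda>u. u / (1 / t)) ` {0..1} = {0..t}"
    using assms image_mult_atLeastAtMost[of t 0 1] by (simp add: mult.commute)
  \<comment> \<open>The substitution \<open>u = t * r\<close> leaves \<open>1 / t\<close> inside
    both powers; multiplying by \<open>t powr (x + y - 2)\<close> clears it.\<close>
  finally have "((\<lambda>u. t powr (x + y - 2) * ((1 / t * u) powr (x - 1) * (1 - 1 / t * u) powr (y - 1)))
      has_integral t powr (x + y - 2) * (t * Beta x y)) {0..t}"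
    by (rule has_integral_mult_right)
  also have "?this \<longleftrightarrow> ((\<lambda>u. u powr (x - 1) * (t - u) powr (y - 1)) has_integral
      t powr (x + y - 2) * (t * Beta x y)) {0..t}"
  proof (rule has_integral_cong)
    fix u assume u: "u \<in> {0..t}"
    have "1 - 1 / t * u = (t - u) / t" using assms by (simp add: field_simps)
    moreover have "t powr (x + y - 2) = t powr (x - 1) * t powr (y - 1)"
      by (simp flip: powr_add)
    ultimately show "t powr (x + y - 2) * ((1 / t * u) powr (x - 1) * (1 - 1 / t * u) powr (y - 1)) =
        u powr (x - 1) * (t - u) powr (y - 1)"
      using u assms by (simp add: powr_divide)
  qed
  also have "t powr (x + y - 2) * (t * Beta x y) = t powr (x + y - 1) * Beta x y"
    using assms by (simp add: powr_mult_base[of t "x + y - 2"] flip: mult.assoc) (simp add: mult.commute powr_mult_base)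
  finally show ?thesis .
qed

section \<open>One-sided moments and their series\<close>

definition left_moment :: "real \<Rightarrow> real \<Rightarrow> real \<Rightarrow> (real \<Rightarrow> real) \<Rightarrow> real" where
  "left_moment a b t q =
     integral {0..t} (\<lambda>u. (t - u) powr (a + b - 1) * u powr (- b) * (1 - u) powr (- a) * q u)"

definition right_moment :: "real \<Rightarrow> real \<Rightarrow> real \<Rightarrow> (real \<Rightarrow> real) \<Rightarrow> real" where
  "right_moment a b t q =
     integral {t..1} (\<lambda>u. (u - t) powr (a + b - 1) * u powr (- b) * (1 - u) powr (- a) * q u)"

lemma integral_one_minus:
  fixes f :: "real \<Rightarrow> real"
  shows "integral {0..1 - t} (\<lambda>u. f (1 - u)) = integral {t..1} f"
  using integral_shift_real_ivl[of "-1" "-1" "-t" "\<lambda>u. f (- u)"]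
    Henstock_Kurzweil_Integration.integral_reflect_real[of 1 t f]
  by (simp add: algebra_simps)

text \<open>The reflection of \<open>u\<close> to \<open>1 - u\<close> exchanges \<open>a\<close>
  with \<open>b\<close> and \<open>t\<close> with \<open>1 - t\<close>; through it every fact on
  left moments also serves for right ones.\<close>

lemma right_moment_eq_left: "right_moment a b t q = left_moment b a (1 - t) (\<lambda>u. q (1 - u))"
  unfolding right_moment_def left_moment_def integral_one_minus [symmetric]
  by (simp add: algebra_simps)

locale frac_exponents =
  fixes a b t :: real
  assumes a: "0 \<le> a" and b: "0 \<le> b" and ab_pos: "0 < a + b" and ab_less: "a + b < 1"
    and t: "0 < t" "t < 1"
begin

lemma frac_exponents_swap: "frac_exponents b a (1 - t)"
  using a b ab_pos ab_less t by unfold_locales auto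

text \<open>The singularities at \<open>0\<close> and \<open>t\<close> form a scaled Beta kernel;
  the remaining factor is continuous on \<open>{0..t}\<close> because \<open>t < 1\<close>.\<close>

lemma left_integrable:
  assumes "continuous_on {0..1} q"
  shows "(\<lambda>u. (t - u) powr (a + b - 1) * u powr (- b) * (1 - u) powr (- a) * q u) integrable_on {0..t}"
proof -
  have "((\<lambda>u. u powr ((1 - b) - 1) * (t - u) powr ((a + b) - 1)) has_integral
      t powr ((1 - b) + (a + b) - 1) * Beta (1 - b) (a + b)) {0..t}"
    using a b ab_pos ab_less t by (intro has_integral_Beta_scaled) auto
  hence "(\<lambda>u. (t - u) powr (a + b - 1) * u powr (- b)) integrable_on {0..t}"
    by (auto simp: mult.commute)
  hence "(\<lambda>u. (t - u) powr (a + b - 1) * u powr (- b) * ((1 - u) powr (- a) * q u)) integrable_on {0..t}"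
  proof (rule integrable_mult_continuous)
    show "continuous_on {0..t} (\<lambda>u. (1 - u) powr (- a) * q u)"
      using t by (intro continuous_intros continuous_on_subset[OF assms]) auto
  qed auto
  thus ?thesis by (simp add: mult.assoc)
qed

lemma left_moment_add:
  assumes "continuous_on {0..1} q" "continuous_on {0..1} r"
  shows "left_moment a b t (\<lambda>u. q u + r u) = left_moment a b t q + left_moment a b t r"
  unfolding left_moment_def distrib_left
  by (rule Henstock_Kurzweil_Integration.integral_add) (intro left_integrable assms)+

lemma left_moment_diff:
  assumes "continuous_on {0..1} q" "continuous_on {0..1} r"
  shows "left_moment a b t (\<lambda>u. q u - r u) = left_moment a b t q - left_moment a b t r"
  unfolding left_moment_def right_diff_distrib
  by (rule Henstock_Kurzweil_Integration.integral_diff) (intro left_integrable assms)+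

lemma left_moment_cmult: "left_moment a b t (\<lambda>u. c * q u) = c * left_moment a b t q"
  unfolding left_moment_def mult.left_commute[of _ c] by simp

text \<open>Expand \<open>(1 - u) powr (- a)\<close> in its binomial series. The coefficients are
  nonnegative as \<open>a\<close> is, so the series may be integrated termwise, each term being a
  scaled Beta integral.\<close>

lemma left_moment_sums:
  "(\<lambda>k. pochhammer a k / fact k * (t powr (real j + real k + a) * Beta (real j + real k + 1 - b) (a + b)))
     sums left_moment a b t (\<lambda>u. u ^ j)"
  unfolding left_moment_def
proof (rule nonneg_sums_integral)
  fix k
  have "((\<lambda>u. pochhammer a k / fact k * (u powr ((real j + real k + 1 - b) - 1) * (t - u) powr ((a + b) - 1))) has_integral
      pochhammer a k / fact k * (t powr ((real j + real k + 1 - b) + (a + b) - 1) * Beta (real j + real k + 1 - b) (a + b))) {0..t}"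
    using a b ab_pos ab_less t by (intro has_integral_mult_right has_integral_Beta_scaled) auto
  thus "((\<lambda>u. pochhammer a k / fact k * (u powr (real j + real k - b) * (t - u) powr (a + b - 1))) has_integral
      pochhammer a k / fact k * (t powr (real j + real k + a) * Beta (real j + real k + 1 - b) (a + b))) {0..t}"
    by (simp add: algebra_simps)
next
  fix k u
  show "0 \<le> pochhammer a k / fact k * (u powr (real j + real k - b) * (t - u) powr (a + b - 1))"
    using a by (auto intro!: mult_nonneg_nonneg divide_nonneg_nonneg simp: pochhammer_nonneg pochhammer_prod prod_nonneg)
next
  fix u assume u: "u \<in> {0..t}"
  have "(\<lambda>k. pochhammer a k / fact k * u ^ k) sums (1 - u) powr (- a)"
    using u t by (intro one_minus_powr_sums) auto
  hence sums: "(\<lambda>k. ((t - u) powr (a + b - 1) * u powr (- b) * u ^ j) * (pochhammer a k / fact k * u ^ k)) sums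
     (((t - u) powr (a + b - 1) * u powr (- b) * u ^ j) * (1 - u) powr (- a))"
    by (rule sums_mult)
  \<comment> \<open>At \<open>u = 0\<close> both sides vanish because \<open>0 powr\<close> anything
    is 0, even where the exponent is not positive.\<close>
  have pw: "u powr (real j + real k - b) = u powr (- b) * (u ^ j * u ^ k)" for k
  proof (cases "u = 0")
    case False
    thus ?thesis using u by (simp add: powr_realpow powr_add powr_diff powr_minus field_simps)
  qed auto
  note sums
  moreover have "((t - u) powr (a + b - 1) * u powr (- b) * u ^ j) * (pochhammer a k / fact k * u ^ k) =
      pochhammer a k / fact k * (u powr (real j + real k - b) * (t - u) powr (a + b - 1))" for k
    unfolding pw by (simp add: mult_ac)
  ultimately have "(\<lambda>k. pochhammer a k / fact k * (u powr (real j + real k - b) * (t - u) powr (a + b - 1))) sums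
     (((t - u) powr (a + b - 1) * u powr (- b) * u ^ j) * (1 - u) powr (- a))"
    by (simp only:)
  thus "(\<lambda>k. pochhammer a k / fact k * (u powr (real j + real k - b) * (t - u) powr (a + b - 1))) sums
     ((t - u) powr (a + b - 1) * u powr (- b) * (1 - u) powr (- a) * u ^ j)"
    by (simp add: mult_ac)
next
  show "(\<lambda>u. (t - u) powr (a + b - 1) * u powr (- b) * (1 - u) powr (- a) * u ^ j) integrable_on {0..t}"
    by (intro left_integrable continuous_intros)
qed

text \<open>The same method applied to \<open>(1 - r) powr (b - 1)\<close>; here
  \<open>b < 1\<close> makes the coefficients \<open>pochhammer (1 - b) k\<close>
  nonnegative.\<close>

lemma incomplete_Beta_sums:
  assumes x: "x > 0" and b: "b > 0"
  shows "(\<lambda>k. pochhammer (1 - b) k / fact k * (t powr (x + real k) / (x + real k)))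
     sums integral {0..t} (\<lambda>r. r powr (x - 1) * (1 - r) powr (b - 1))"
proof (rule nonneg_sums_integral)
  fix k
  show "((\<lambda>r. pochhammer (1 - b) k / fact k * r powr (x + real k - 1)) has_integral
      pochhammer (1 - b) k / fact k * (t powr (x + real k) / (x + real k))) {0..t}"
    using has_integral_powr_from_0[of "x + real k - 1" t] x t by (intro has_integral_mult_right) auto
next
  fix k r
  have "0 \<le> 1 - b" using a ab_less by auto
  thus "0 \<le> pochhammer (1 - b) k / fact k * r powr (x + real k - 1)"
    by (auto intro!: mult_nonneg_nonneg divide_nonneg_nonneg simp: pochhammer_nonneg pochhammer_prod prod_nonneg)
next
  fix r assume r: "r \<in> {0..t}"
  have "(\<lambda>k. pochhammer (1 - b) k / fact k * r ^ k) sums (1 - r) powr (- (1 - b))"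
    using r t by (intro one_minus_powr_sums) auto
  hence "(\<lambda>k. r powr (x - 1) * (pochhammer (1 - b) k / fact k * r ^ k)) sums (r powr (x - 1) * (1 - r) powr (- (1 - b)))"
    by (rule sums_mult)
  moreover have "r powr (x - 1) * r ^ k = r powr (x + real k - 1)" for k
  proof (cases "r = 0")
    case False
    thus ?thesis using r by (simp add: powr_diff powr_add powr_realpow)
  qed auto
  hence "r powr (x - 1) * (pochhammer (1 - b) k / fact k * r ^ k) = pochhammer (1 - b) k / fact k * r powr (x + real k - 1)" for k
    by (metis mult.left_commute)
  ultimately show "(\<lambda>k. pochhammer (1 - b) k / fact k * r powr (x + real k - 1)) sums (r powr (x - 1) * (1 - r) powr (b - 1))"
    by (simp only: minus_diff_eq)
next
  show "(\<lambda>r. r powr (x - 1) * (1 - r) powr (b - 1)) integrable_on {0..t}"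
    by (rule integrable_subinterval_real[OF has_integral_integrable[OF has_integral_Beta_real[OF x b]]]) (use t in auto)
qed

text \<open>Comparison of the two preceding series term by term: the Gamma quotients in
  \<open>pochhammer a k * Beta (real k + 1 - b) (a + b)\<close> collapse to
  \<open>pochhammer (1 - b) k / (a + real k)\<close> up to the constant \<open>c\<close>.\<close>

lemma
  assumes "a > 0" "b > 0"
  defines "c \<equiv> Gamma (a + b) * Gamma (1 - b) / Gamma a"
    and "\<beta> \<equiv> \<lambda>x. integral {0..t} (\<lambda>r. r powr (x - 1) * (1 - r) powr (b - 1))"
  shows left_moment_0: "left_moment a b t (\<lambda>u. 1) = c * \<beta> a"
    and left_moment_1: "left_moment a b t (\<lambda>u. u) = c * ((1 - a - b) * t * \<beta> a + (a + b) * \<beta> (a + 1))"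
proof -
  have nz: "a \<notin> \<int>\<^sub>\<le>\<^sub>0" "1 - b \<notin> \<int>\<^sub>\<le>\<^sub>0"
    using assms(1,2) a ab_less by (auto elim!: nonpos_Ints_cases)
  have Ga: "Gamma a > 0" using assms by simp
  have Beta_eq: "pochhammer a k * Beta (real k + 1 - b) (a + b) = c * pochhammer (1 - b) k / (a + real k)" for k
  proof -
    have "Gamma (real k + 1 - b) = pochhammer (1 - b) k * Gamma (1 - b)"
      using pochhammer_Gamma[OF nz(2), of k] nz by (simp add: Gamma_eq_zero_iff field_simps)
    moreover have "Gamma (a + real (Suc k)) = pochhammer a k * (a + real k) * Gamma a"
      using pochhammer_Gamma[OF nz(1), of "Suc k"] nz by (simp add: Gamma_eq_zero_iff field_simps pochhammer_Suc)
    moreover have "pochhammer a k > 0" using assms by (simp add: pochhammer_pos)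
    moreover have "a + real k > 0" using assms by simp
    ultimately show ?thesis using Ga
      by (simp add: Beta_def c_def add.commute add.left_commute) (simp add: divide_simps)
  qed
  have \<beta>0: "(\<lambda>k. pochhammer (1 - b) k / fact k * (t powr (a + real k) / (a + real k))) sums \<beta> a"
    unfolding \<beta>_def using assms by (intro incomplete_Beta_sums)
  have \<beta>1: "(\<lambda>k. pochhammer (1 - b) k / fact k * (t powr (a + 1 + real k) / (a + 1 + real k))) sums \<beta> (a + 1)"
    unfolding \<beta>_def using assms by (intro incomplete_Beta_sums) auto
  have "(\<lambda>k. c * (pochhammer (1 - b) k / fact k * (t powr (a + real k) / (a + real k)))) sums (c * \<beta> a)"
    by (intro sums_mult \<beta>0)
  also have "(\<lambda>k. c * (pochhammer (1 - b) k / fact k * (t powr (a + real k) / (a + real k)))) =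
    (\<lambda>k. pochhammer a k / fact k * (t powr (real 0 + real k + a) * Beta (real 0 + real k + 1 - b) (a + b)))"
  proof
    fix k
    show "c * (pochhammer (1 - b) k / fact k * (t powr (a + real k) / (a + real k))) = 
      pochhammer a k / fact k * (t powr (real 0 + real k + a) * Beta (real 0 + real k + 1 - b) (a + b))"
      using arg_cong[OF Beta_eq[of k], of "\<lambda>z. t powr (a + real k) / fact k * z"] by (simp add: add.commute mult_ac)
  qed
  finally show "left_moment a b t (\<lambda>u. 1) = c * \<beta> a"
    using left_moment_sums[of 0] sums_unique2 by fastforce
  have "(\<lambda>k. c * ((1 - a - b) * t * (pochhammer (1 - b) k / fact k * (t powr (a + real k) / (a + real k))) +
      (a + b) * (pochhammer (1 - b) k / fact k * (t powr (a + 1 + real k) / (a + 1 + real k)))))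
     sums (c * ((1 - a - b) * t * \<beta> a + (a + b) * \<beta> (a + 1)))"
    by (intro sums_mult sums_add \<beta>0 \<beta>1)
  also have "(\<lambda>k. c * ((1 - a - b) * t * (pochhammer (1 - b) k / fact k * (t powr (a + real k) / (a + real k))) +
      (a + b) * (pochhammer (1 - b) k / fact k * (t powr (a + 1 + real k) / (a + 1 + real k))))) =
    (\<lambda>k. pochhammer a k / fact k * (t powr (real 1 + real k + a) * Beta (real 1 + real k + 1 - b) (a + b)))"
  proof
    fix k
    have pos: "a + real k > 0" "a + real k + 1 > 0" using assms by auto
    have "(real k + 1 - b + (a + b)) * Beta (real k + 1 - b + 1) (a + b) = (real k + 1 - b) * Beta (real k + 1 - b) (a + b)"
      using assms a ab_less by (intro Beta_plus1_left) (auto elim!: nonpos_Ints_cases)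
    hence B: "Beta (real 1 + real k + 1 - b) (a + b) = (real k + 1 - b) / (a + real k + 1) * Beta (real k + 1 - b) (a + b)"
      using pos by (simp add: field_simps)
    have T: "t powr (real 1 + real k + a) = t * t powr (a + real k)" "t powr (a + 1 + real k) = t * t powr (a + real k)"
      using t by (simp_all add: powr_mult_base add_ac)
    have "pochhammer a k / fact k * (t powr (real 1 + real k + a) * Beta (real 1 + real k + 1 - b) (a + b)) =
       t * t powr (a + real k) / fact k * ((real k + 1 - b) / (a + real k + 1)) * (pochhammer a k * Beta (real k + 1 - b) (a + b))"
      unfolding B T by (simp add: mult_ac)
    also have "\<dots> = c * pochhammer (1 - b) k * t * t powr (a + real k) / fact k * ((real k + 1 - b) / ((a + real k) * (a + real k + 1)))"
      unfolding Beta_eq by (simp add: mult_ac)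
    \<comment> \<open>Partial fractions: the two summands belong to the series of
      \<open>\<beta> a\<close> and of \<open>\<beta> (a + 1)\<close>.\<close>
    also have "(real k + 1 - b) / ((a + real k) * (a + real k + 1)) = (1 - a - b) / (a + real k) + (a + b) / (a + 1 + real k)"
      using pos by (simp add: divide_simps) (simp add: algebra_simps)
    finally show "c * ((1 - a - b) * t * (pochhammer (1 - b) k / fact k * (t powr (a + real k) / (a + real k))) +
      (a + b) * (pochhammer (1 - b) k / fact k * (t powr (a + 1 + real k) / (a + 1 + real k)))) =
      pochhammer a k / fact k * (t powr (real 1 + real k + a) * Beta (real 1 + real k + 1 - b) (a + b))"
      unfolding T by (simp add: algebra_simps)
  qed
  finally show "left_moment a b t (\<lambda>u. u) = c * ((1 - a - b) * t * \<beta> a + (a + b) * \<beta> (a + 1))"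
    using left_moment_sums[of 1] sums_unique2 by fastforce
qed

end

text \<open>The integrand is the derivative of
  \<open>(t - u) powr s * u powr x * (1 - u) powr y\<close>, which vanishes at both ends as
  \<open>s\<close> and \<open>x\<close> are positive. The derivative may blow up there, so the
  version of the fundamental theorem for the open interval is used.\<close>

lemma Jacobi_kernel_FTC:
  fixes s x y t :: real
  assumes "s > 0" "x > 0" "0 < t" "t < 1"
  shows "((\<lambda>u. (t - u) powr (s - 1) * u powr (x - 1) * (1 - u) powr (y - 1) *
            (x * (t - u) * (1 - u) - y * (t - u) * u - s * u * (1 - u))) has_integral 0) {0..t}"
proof -
  let ?G = "\<lambda>u. (t - u) powr s * u powr x * (1 - u) powr y"
  have "((\<lambda>u. (t - u) powr (s - 1) * u powr (x - 1) * (1 - u) powr (y - 1) *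
            (x * (t - u) * (1 - u) - y * (t - u) * u - s * u * (1 - u))) has_integral ?G t - ?G 0) {0..t}"
  proof (rule fundamental_theorem_of_calculus_interior)
    show "continuous_on {0..t} ?G"
      using assms by (intro continuous_on_mult continuous_on_powr' continuous_intros) auto
    fix u assume u: "u \<in> {0<..<t}"
    have P: "(t - u) powr s = (t - u) powr (s - 1) * (t - u)" "u powr x = u powr (x - 1) * u"
        "(1 - u) powr y = (1 - u) powr (y - 1) * (1 - u)"
      using u assms by (simp_all add: powr_mult_base mult.commute)
    have "(?G has_real_derivative
        (s * (t - u) powr (s - 1) * (-1)) * u powr x * (1 - u) powr y
        + (t - u) powr s * (x * u powr (x - 1)) * (1 - u) powr y
        + (t - u) powr s * u powr x * (y * (1 - u) powr (y - 1) * (-1))) (at u)"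
      using u assms by (auto intro!: derivative_eq_intros simp: algebra_simps powr_diff)
    also have "(s * (t - u) powr (s - 1) * (-1)) * u powr x * (1 - u) powr y
        + (t - u) powr s * (x * u powr (x - 1)) * (1 - u) powr y
        + (t - u) powr s * u powr x * (y * (1 - u) powr (y - 1) * (-1)) =
       (t - u) powr (s - 1) * u powr (x - 1) * (1 - u) powr (y - 1) *
            (x * (t - u) * (1 - u) - y * (t - u) * u - s * u * (1 - u))"
      unfolding P by (simp add: algebra_simps)
    finally show "(?G has_vector_derivative (t - u) powr (s - 1) * u powr (x - 1) * (1 - u) powr (y - 1) *
            (x * (t - u) * (1 - u) - y * (t - u) * u - s * u * (1 - u))) (at u)"
      by (simp add: has_real_derivative_iff_has_vector_derivative)
  qed (use assms in auto)
  thus ?thesis using assms by simp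
qed

lemma Gamma_reflection_real: "Gamma x * Gamma (1 - x) = pi / sin (pi * x)" for x :: real
proof -
  have "complex_of_real (Gamma x * Gamma (1 - x)) = of_real (pi / sin (pi * x))"
    using Gamma_reflection_complex[of "of_real x"]
    by (simp add: Gamma_complex_of_real [symmetric] sin_of_real [symmetric])
  thus ?thesis by (simp only: of_real_eq_iff)
qed

lemma Beta_plus1_left_real:
  assumes "(x::real) > 0" "y > 0"
  shows "Beta (x + 1) y = x / (x + y) * Beta x y"
proof -
  have "(x + y) * Beta (x + 1) y = x * Beta x y"
    using assms by (intro Beta_plus1_left) (auto elim!: nonpos_Ints_cases)
  thus ?thesis using assms by (simp add: field_simps)
qed

section \<open>The sine-weighted moment functional\<close>

context frac_exponents
begin

interpretation swap: frac_exponents b a "1 - t" by (rule frac_exponents_swap)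

text \<open>The weights are crossed: the left integral gets the sine of \<open>b\<close>. By the
  condition on \<open>p\<close> they are proportional to \<open>p\<close> and
  \<open>1 - p\<close>.\<close>

definition moment :: "(real \<Rightarrow> real) \<Rightarrow> real" where
  "moment q = sin (pi * b) * left_moment a b t q + sin (pi * a) * right_moment a b t q"

lemma moment_add:
  assumes "continuous_on {0..1} q" "continuous_on {0..1} r"
  shows "moment (\<lambda>u. q u + r u) = moment q + moment r"
  using left_moment_add[OF assms] swap.left_moment_add[of "\<lambda>u. q (1 - u)" "\<lambda>u. r (1 - u)"] assms
  by (simp add: moment_def right_moment_eq_left algebra_simps continuous_on_compose2[of "{0..1}" _ "{0..1}" "\<lambda>u. 1 - u"] continuous_intros image_subset_iff)

lemma moment_diff:
  assumes "continuous_on {0..1} q" "continuous_on {0..1} r"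
  shows "moment (\<lambda>u. q u - r u) = moment q - moment r"
  using left_moment_diff[OF assms] swap.left_moment_diff[of "\<lambda>u. q (1 - u)" "\<lambda>u. r (1 - u)"] assms
  by (simp add: moment_def right_moment_eq_left right_diff_distrib continuous_on_compose2[of "{0..1}" _ "{0..1}" "\<lambda>u. 1 - u"] continuous_intros image_subset_iff)

lemma moment_cmult: "moment (\<lambda>u. c * q u) = c * moment q"
  by (simp add: moment_def right_moment_eq_left left_moment_cmult swap.left_moment_cmult algebra_simps)

lemma moment_sum:
  assumes "finite A" "\<And>i. i \<in> A \<Longrightarrow> continuous_on {0..1} (f i)"
  shows "moment (\<lambda>u. \<Sum>i\<in>A. f i u) = (\<Sum>i\<in>A. moment (f i))"
  using assms
proof (induction A rule: finite_induct)
  case empty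
  show ?case using moment_cmult[of 0 "\<lambda>_. 0"] by simp
next
  case (insert i A)
  hence "moment (\<lambda>u. f i u + (\<Sum>i\<in>A. f i u)) = moment (f i) + moment (\<lambda>u. \<Sum>i\<in>A. f i u)"
    by (intro moment_add continuous_on_sum) auto
  thus ?case using insert by simp
qed

lemma right_moment_1:
  "right_moment a b t (\<lambda>u. u) = right_moment a b t (\<lambda>u. 1) - left_moment b a (1 - t) (\<lambda>u. u)"
  unfolding right_moment_eq_left by (intro swap.left_moment_diff continuous_intros)

text \<open>After reflection the right moments are incomplete Beta integrals over
  \<open>{t..1}\<close> with the same integrand as the left ones over \<open>{0..t}\<close>. The
  sine weights give both the same prefactor, so the pieces add up to complete Beta
  integrals.\<close>

lemma moment_base_pos:
  assumes "a > 0" "b > 0"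
  shows "moment (\<lambda>u. 1) = pi \<and> moment (\<lambda>u. u) = pi * ((1 - a - b) * t + a)"
proof -
  define \<beta> where "\<beta> x = integral {0..t} (\<lambda>r. r powr (x - 1) * (1 - r) powr (b - 1))" for x
  define \<gamma> where "\<gamma> x = integral {t..1} (\<lambda>r. r powr (x - 1) * (1 - r) powr (b - 1))" for x
  define \<gamma>' where "\<gamma>' = integral {t..1} (\<lambda>r. r powr (a - 1) * (1 - r) powr b)"
  have int: "(\<lambda>r. r powr (x - 1) * (1 - r) powr (y - 1)) integrable_on {c..d}"
    if "x > 0" "y > 0" "{c..d} \<subseteq> {0..1}" for x y c d :: real
    by (rule integrable_subinterval_real[OF has_integral_integrable[OF has_integral_Beta_real[OF that(1,2)]] that(3)])
  have Beta: "\<beta> x + \<gamma> x = Beta x b" if "x > 0" for x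
  proof -
    have "\<beta> x + \<gamma> x = integral {0..1} (\<lambda>r. r powr (x - 1) * (1 - r) powr (b - 1))"
      unfolding \<beta>_def \<gamma>_def using t assms that
      by (intro Henstock_Kurzweil_Integration.integral_combine int) auto
    thus ?thesis using has_integral_Beta_real[OF that assms(2)] by (simp add: integral_unique)
  qed
  have refl: "integral {0..1 - t} (\<lambda>r. r powr (x - 1) * (1 - r) powr (y - 1)) =
      integral {t..1} (\<lambda>r. r powr (y - 1) * (1 - r) powr (x - 1))" for x y
    using integral_one_minus[of t "\<lambda>r. r powr (y - 1) * (1 - r) powr (x - 1)"] by (simp add: mult.commute)
  \<comment> \<open>Reflecting the formula for the first moment raises the exponent of
    \<open>1 - r\<close> instead of that of \<open>r\<close>; splitting off one factor
    \<open>1 - r\<close> repairs this.\<close>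
  have \<gamma>': "\<gamma>' = \<gamma> a - \<gamma> (a + 1)"
  proof -
    have "\<gamma> a - \<gamma> (a + 1) = integral {t..1} (\<lambda>r. r powr (a - 1) * (1 - r) powr (b - 1) - r powr (a + 1 - 1) * (1 - r) powr (b - 1))"
      unfolding \<gamma>_def using assms t
      by (intro Henstock_Kurzweil_Integration.integral_diff [symmetric] int) auto
    also have "\<dots> = \<gamma>'"
      unfolding \<gamma>'_def
    proof (rule integral_cong)
      fix r assume r: "r \<in> {t..1}"
      have "r powr (a + 1 - 1) = r powr (a - 1) * r" "(1 - r) powr b = (1 - r) powr (b - 1) * (1 - r)"
        using r t powr_mult_base[of r "a - 1"] powr_mult_base[of "1 - r" "b - 1"] by (simp_all add: mult.commute)
      thus "r powr (a - 1) * (1 - r) powr (b - 1) - r powr (a + 1 - 1) * (1 - r) powr (b - 1) = r powr (a - 1) * (1 - r) powr b"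
        by (simp only:) (simp add: algebra_simps)
    qed
    finally show ?thesis ..
  qed
  define cL where "cL = Gamma (a + b) * Gamma (1 - b) / Gamma a"
  define cR where "cR = Gamma (a + b) * Gamma (1 - a) / Gamma b"
  have G: "Gamma a > 0" "Gamma b > 0" "Gamma (a + b) > 0" using assms by auto
  hence nz: "Gamma a \<noteq> 0" "Gamma b \<noteq> 0" "Gamma (a + b) \<noteq> 0" by linarith+
  have s: "sin (pi * a) > 0" "sin (pi * b) > 0"
    using assms ab_less by (auto intro!: sin_gt_zero)
  have refl_a: "Gamma a * Gamma (1 - a) = pi / sin (pi * a)"
    and refl_b: "Gamma b * Gamma (1 - b) = pi / sin (pi * b)"
    using Gamma_reflection_real by blast+
  \<comment> \<open>The common prefactor: Gamma reflection replaces each sine by a quotient of Gamma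
    values.\<close>
  define K where "K = pi * Gamma (a + b) / (Gamma a * Gamma b)"
  have cL: "sin (pi * b) * cL = K"
    using refl_b s G by (simp add: cL_def K_def field_simps)
  have cR: "sin (pi * a) * cR = K"
    using refl_a s G by (simp add: cR_def K_def field_simps)
  have K: "K * Beta a b = pi" "K * Beta (a + 1) b = pi * a / (a + b)"
    using assms nz by (simp_all add: K_def Beta_plus1_left_real) (simp_all add: Beta_def)
  have L0: "left_moment a b t (\<lambda>u. 1) = cL * \<beta> a"
    and L1: "left_moment a b t (\<lambda>u. u) = cL * ((1 - a - b) * t * \<beta> a + (a + b) * \<beta> (a + 1))"
    using left_moment_0 left_moment_1 assms by (simp_all add: cL_def \<beta>_def)
  have R0: "right_moment a b t (\<lambda>u. 1) = cR * \<gamma> a"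
    using swap.left_moment_0 assms by (simp add: right_moment_eq_left cR_def \<gamma>_def refl add.commute)
  have "left_moment b a (1 - t) (\<lambda>u. u) = cR * ((1 - b - a) * (1 - t) * \<gamma> a + (b + a) * \<gamma>')"
    using swap.left_moment_1[OF assms(2,1)] refl[of b a] refl[of "b + 1" a] unfolding cR_def \<gamma>_def \<gamma>'_def
    by (simp add: add.commute)
  hence R1: "right_moment a b t (\<lambda>u. u) = cR * ((1 - a - b) * t * \<gamma> a + (a + b) * \<gamma> (a + 1))"
    unfolding right_moment_1 R0 \<gamma>' by (simp add: algebra_simps)
  have "moment (\<lambda>u. 1) = sin (pi * b) * cL * \<beta> a + sin (pi * a) * cR * \<gamma> a"
    unfolding moment_def L0 R0 by simp
  also have "\<dots> = K * (\<beta> a + \<gamma> a)" unfolding cL cR by (simp add: algebra_simps)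
  also have "\<dots> = pi" using Beta[of a] K assms by simp
  finally have 1: "moment (\<lambda>u. 1) = pi" .
  have "moment (\<lambda>u. u) = sin (pi * b) * cL * ((1 - a - b) * t * \<beta> a + (a + b) * \<beta> (a + 1)) + 
      sin (pi * a) * cR * ((1 - a - b) * t * \<gamma> a + (a + b) * \<gamma> (a + 1))"
    unfolding moment_def L1 R1 by simp
  also have "\<dots> = (1 - a - b) * t * (K * (\<beta> a + \<gamma> a)) + (a + b) * (K * (\<beta> (a + 1) + \<gamma> (a + 1)))"
    unfolding cL cR by (simp add: algebra_simps)
  also have "\<dots> = pi * ((1 - a - b) * t + a)"
    using Beta[of a] Beta[of "a + 1"] K assms by (simp add: field_simps)
  finally show ?thesis using 1 by simp
qed

text \<open>For \<open>a = 0\<close> only the term \<open>k = 0\<close> of the series survives,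
  leaving one Beta integral, and Gamma reflection cancels the sine. This covers the boundary case,
  where the prefactors of the positive case involve Gamma at its pole 0.\<close>

lemma left_moment_power_a0:
  assumes "a = 0"
  shows "sin (pi * b) * left_moment a b t (\<lambda>u. u ^ j) = pi * pochhammer (1 - b) j / fact j * t ^ j"
proof -
  have "left_moment a b t (\<lambda>u. u ^ j) = t powr (real j) * Beta (real j + 1 - b) b"
  proof -
    have "(\<lambda>k. if k = 0 then t powr (real j) * Beta (real j + 1 - b) b else 0) sums (t powr (real j) * Beta (real j + 1 - b) b)"
      by (rule sums_single)
    also have "(\<lambda>k. if k = 0 then t powr (real j) * Beta (real j + 1 - b) b else 0) =
       (\<lambda>k. pochhammer a k / fact k * (t powr (real j + real k + a) * Beta (real j + real k + 1 - b) (a + b)))"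
      using assms by (auto simp: fun_eq_iff pochhammer_0_left)
    finally show ?thesis using left_moment_sums[of j] sums_unique2 by blast
  qed
  moreover have "Beta (real j + 1 - b) b = pochhammer (1 - b) j * Gamma (1 - b) * Gamma b / fact j"
  proof -
    have "1 - b \<notin> \<int>\<^sub>\<le>\<^sub>0" using assms ab_less by (auto elim!: nonpos_Ints_cases)
    hence "Gamma (real j + 1 - b) = pochhammer (1 - b) j * Gamma (1 - b)"
      using pochhammer_Gamma[of "1 - b" j] by (simp add: Gamma_eq_zero_iff field_simps)
    thus ?thesis using Gamma_fact[of j, where ?'a = real] by (simp add: Beta_def add.commute)
  qed
  ultimately have "sin (pi * b) * left_moment a b t (\<lambda>u. u ^ j) =
      (sin (pi * b) * (Gamma b * Gamma (1 - b))) * pochhammer (1 - b) j / fact j * t ^ j"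
    using t by (simp add: powr_realpow)
  also have "sin (pi * b) \<noteq> 0"
    using sin_gt_zero[of "pi * b"] assms ab_less ab_pos by simp
  hence "sin (pi * b) * (Gamma b * Gamma (1 - b)) = pi"
    unfolding Gamma_reflection_real by simp
  finally show ?thesis .
qed

end

section \<open>First two moments and the three-term recurrence\<close>

context frac_exponents
begin

interpretation swap: frac_exponents b a "1 - t" by (rule frac_exponents_swap)

lemma moment_base:
  shows moment_0: "moment (\<lambda>u. 1) = pi" and moment_1: "moment (\<lambda>u. u) = pi * ((1 - a - b) * t + a)"
proof -
  have "moment (\<lambda>u. 1) = pi \<and> moment (\<lambda>u. u) = pi * ((1 - a - b) * t + a)"
  \<comment> \<open>If one exponent is 0, its sine weight removes one of the two integrals, and the
    other is known explicitly.\<close>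
  proof (cases "a = 0 \<or> b = 0")
    case False
    thus ?thesis using moment_base_pos a b by auto
  next
    case True
    then consider "a = 0" | "b = 0" by blast
    thus ?thesis
    proof cases
      case 1
      thus ?thesis using left_moment_power_a0[of 0] left_moment_power_a0[of 1] unfolding moment_def by simp
    next
      case 2
      have "sin (pi * a) * right_moment a b t (\<lambda>u. 1) = pi"
        using swap.left_moment_power_a0[OF 2, of 0] by (simp add: right_moment_eq_left)
      moreover have "sin (pi * a) * left_moment b a (1 - t) (\<lambda>u. u) = pi * (1 - a) * (1 - t)"
        using swap.left_moment_power_a0[OF 2, of 1] by simp
      ultimately show ?thesis using 2 unfolding moment_def right_moment_1 by (simp add: algebra_simps)
    qed
  qed
  thus "moment (\<lambda>u. 1) = pi" "moment (\<lambda>u. u) = pi * ((1 - a - b) * t + a)" by auto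
qed

text \<open>The polynomial factor in \<open>Jacobi_kernel_FTC\<close> for \<open>s = a + b\<close>,
  \<open>x = j + 1 - b\<close>, \<open>y = 1 - a\<close> is quadratic in \<open>u\<close> with
  leading coefficient \<open>x + y + s = j + 2\<close>. Its moment against \<open>u ^ j\<close> is 0
  on either side of \<open>t\<close>, and linearity turns this into the recurrence.\<close>

lemma moment_recurrence:
  "real (j + 2) * moment (\<lambda>u. u ^ (j + 2)) =
     (real (j + 1) * (1 + t) + (1 - a - b) * t + a) * moment (\<lambda>u. u ^ (j + 1)) - (real (j + 1) - b) * t * moment (\<lambda>u. u ^ j)"
proof -
  let ?x = "real j + 1 - b" and ?y = "1 - a" and ?s = "a + b"
  have split: "u powr (real j - b) = u powr (- b) * u ^ j" if "u \<ge> 0" for u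
  proof (cases "u = 0")
    case False
    thus ?thesis using that by (simp add: powr_diff powr_minus powr_realpow field_simps)
  qed auto
  have "left_moment a b t (\<lambda>u. u ^ j * (?x * (t - u) * (1 - u) - ?y * (t - u) * u - ?s * u * (1 - u))) = 0"
    unfolding left_moment_def
  proof (rule integral_unique)
    have "((\<lambda>u. (t - u) powr (?s - 1) * u powr (?x - 1) * (1 - u) powr (?y - 1) *
            (?x * (t - u) * (1 - u) - ?y * (t - u) * u - ?s * u * (1 - u))) has_integral 0) {0..t}"
      using a b ab_pos ab_less t by (intro Jacobi_kernel_FTC) auto
    thus "((\<lambda>u. (t - u) powr (a + b - 1) * u powr (- b) * (1 - u) powr (- a) *
       (u ^ j * (?x * (t - u) * (1 - u) - ?y * (t - u) * u - ?s * u * (1 - u)))) has_integral 0) {0..t}"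
      by (rule has_integral_eq[rotated]) (simp add: split)
  qed
  \<comment> \<open>Reflection reduces the right side to the same lemma at \<open>1 - t\<close> with
    the exponents \<open>?x\<close> and \<open>?y\<close> exchanged.\<close>
  moreover have "right_moment a b t (\<lambda>u. u ^ j * (?x * (t - u) * (1 - u) - ?y * (t - u) * u - ?s * u * (1 - u))) = 0"
    unfolding right_moment_eq_left left_moment_def
  proof (rule integral_unique)
    have "((\<lambda>u. (1 - t - u) powr (?s - 1) * u powr (?y - 1) * (1 - u) powr (?x - 1) *
            (?y * (1 - t - u) * (1 - u) - ?x * (1 - t - u) * u - ?s * u * (1 - u))) has_integral 0) {0..1 - t}"
      using a b ab_pos ab_less t by (intro Jacobi_kernel_FTC) auto
    thus "((\<lambda>u. (1 - t - u) powr (b + a - 1) * u powr (- a) * (1 - u) powr (- b) *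
       ((1 - u) ^ j * (?x * (t - (1 - u)) * (1 - (1 - u)) - ?y * (t - (1 - u)) * (1 - u) - ?s * (1 - u) * (1 - (1 - u))))) has_integral 0) {0..1 - t}"
    proof (rule has_integral_eq[rotated])
      fix u assume u: "u \<in> {0..1 - t}"
      have "(1 - u) powr (?x - 1) = (1 - u) powr (- b) * (1 - u) ^ j"
        using split[of "1 - u"] u t by simp
      moreover have "?y * (1 - t - u) * (1 - u) - ?x * (1 - t - u) * u - ?s * u * (1 - u) =
        ?x * (t - (1 - u)) * (1 - (1 - u)) - ?y * (t - (1 - u)) * (1 - u) - ?s * (1 - u) * (1 - (1 - u))"
        by (simp add: algebra_simps)
      ultimately show "(1 - t - u) powr (?s - 1) * u powr (?y - 1) * (1 - u) powr (?x - 1) *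
            (?y * (1 - t - u) * (1 - u) - ?x * (1 - t - u) * u - ?s * u * (1 - u)) =
       (1 - t - u) powr (b + a - 1) * u powr (- a) * (1 - u) powr (- b) *
       ((1 - u) ^ j * (?x * (t - (1 - u)) * (1 - (1 - u)) - ?y * (t - (1 - u)) * (1 - u) - ?s * (1 - u) * (1 - (1 - u))))"
        by (simp only:) (simp add: add.commute)
    qed
  qed
  ultimately have "moment (\<lambda>u. u ^ j * (?x * (t - u) * (1 - u) - ?y * (t - u) * u - ?s * u * (1 - u))) = 0"
    by (simp add: moment_def)
  also have "(\<lambda>u. u ^ j * (?x * (t - u) * (1 - u) - ?y * (t - u) * u - ?s * u * (1 - u))) =
     (\<lambda>u. (real (j + 2) * u ^ (j + 2) - (real (j + 1) * (1 + t) + (1 - a - b) * t + a) * u ^ (j + 1)) + (real (j + 1) - b) * t * u ^ j)"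
    by (simp add: fun_eq_iff algebra_simps power2_eq_square)
  also have "moment \<dots> = (real (j + 2) * moment (\<lambda>u. u ^ (j + 2)) -
     (real (j + 1) * (1 + t) + (1 - a - b) * t + a) * moment (\<lambda>u. u ^ (j + 1))) + (real (j + 1) - b) * t * moment (\<lambda>u. u ^ j)"
    unfolding moment_cmult [symmetric]
    by (subst moment_add, intro continuous_intros, intro continuous_intros,
        subst moment_diff, intro continuous_intros, intro continuous_intros, rule refl)
  finally show ?thesis by simp
qed

end

section \<open>Generating functions and the closed form of the moments\<close>

lemma convolution_recurrence:
  fixes f g :: "nat \<Rightarrow> real"
  assumes f: "\<And>i. real (i + 1) * f (i + 1) = t * (real i + e) * f i"
    and g: "\<And>i. real (i + 1) * g (i + 1) = (real i + a) * g i"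
  defines "h \<equiv> \<lambda>j. \<Sum>l\<le>j. g l * f (j - l)"
  shows "real (j + 2) * h (j + 2) =
    (real (j + 1) * (1 + t) + e * t + a) * h (j + 1) - (real j + e + a) * t * h j"
proof -
  \<comment> \<open>\<open>F\<close> and \<open>G\<close> are constant multiples of the series of
    \<open>(1 - t X)^(-e)\<close> and \<open>(1 - X)^(-a)\<close>. The two assumptions are
    first-order differential equations for them; the product rule yields one for
    \<open>H = G * F\<close>, and its coefficient at \<open>j + 1\<close> is the claim.\<close>
  define F where "F = Abs_fps f"
  define G where "G = Abs_fps g"
  define H where "H = G * F"
  define c :: "real \<Rightarrow> real fps" where "c = fps_const"
  have F': "fps_deriv F = c t * (fps_X * fps_deriv F) + c (t * e) * F"
  proof (rule fps_ext)
    fix i show "fps_nth (fps_deriv F) i = fps_nth (c t * (fps_X * fps_deriv F) + c (t * e) * F) i"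
      using f[of i] by (cases i) (simp_all add: F_def c_def algebra_simps)
  qed
  have G': "fps_deriv G = fps_X * fps_deriv G + c a * G"
  proof (rule fps_ext)
    fix i show "fps_nth (fps_deriv G) i = fps_nth (fps_X * fps_deriv G + c a * G) i"
      using g[of i] by (cases i) (simp_all add: G_def c_def algebra_simps)
  qed
  have "(1 - c t * fps_X) * (1 - fps_X) * fps_deriv H =
      ((1 - fps_X) * fps_deriv G) * (1 - c t * fps_X) * F + ((1 - c t * fps_X) * fps_deriv F) * (1 - fps_X) * G"
    by (simp add: H_def algebra_simps)
  also have "(1 - fps_X) * fps_deriv G = c a * G" using G' by (simp add: algebra_simps)
  also have "(1 - c t * fps_X) * fps_deriv F = c (t * e) * F" using F' by (simp add: algebra_simps)
  finally have ode: "(1 - c t * fps_X) * (1 - fps_X) * fps_deriv H =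
      c a * G * (1 - c t * fps_X) * F + c (t * e) * F * (1 - fps_X) * G" .
  have "fps_deriv H - (fps_X * fps_deriv H + c t * (fps_X * fps_deriv H)) + c t * (fps_X * (fps_X * fps_deriv H)) =
      (c a * H - c (a * t) * (fps_X * H)) + (c (t * e) * H - c (t * e) * (fps_X * H))"
  proof -
    have "c (a * t) = c a * c t" by (simp add: c_def)
    thus ?thesis using ode by (simp add: H_def algebra_simps)
  qed
  hence "fps_nth (fps_deriv H - (fps_X * fps_deriv H + c t * (fps_X * fps_deriv H)) + c t * (fps_X * (fps_X * fps_deriv H))) (j + 1) =
      fps_nth ((c a * H - c (a * t) * (fps_X * H)) + (c (t * e) * H - c (t * e) * (fps_X * H))) (j + 1)"
    by simp
  moreover have "fps_nth H i = h i" for i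
    by (simp add: H_def G_def F_def h_def fps_mult_nth atMost_atLeast0)
  \<comment> \<open>The doubly shifted term contributes the coefficient of
    \<open>fps_deriv H\<close> at \<open>j - 1\<close>, and 0 if \<open>j = 0\<close>.\<close>
  ultimately show ?thesis
    by (cases j) (simp_all add: c_def algebra_simps)
qed

context frac_exponents
begin

text \<open>The sum is the coefficient of \<open>z^j\<close> in
  \<open>(1 - z)^(-a) (1 - t z)^(a + b - 1)\<close>. It obeys the recurrence of the moments, with
  \<open>e = 1 - a - b\<close>, and has the same first two values up to the factor
  \<open>pi\<close>.\<close>

lemma moment_power:
  "moment (\<lambda>u. u ^ j) =
     pi * (\<Sum>l\<le>j. (- 1) ^ l * (- a gchoose l) * ((real (j - l) - a - b gchoose (j - l)) * t ^ (j - l)))"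
proof -
  define f where "f i = (real i - a - b gchoose i) * t ^ i" for i
  define g where "g l = (- 1) ^ l * (- a gchoose l)" for l
  define h where "h j = (\<Sum>l\<le>j. g l * f (j - l))" for j
  have f: "real (i + 1) * f (i + 1) = t * (real i + (1 - a - b)) * f i" for i
  proof -
    have "real (Suc i) - a - b - 1 = real i - a - b" by simp
    with gbinomial_absorption[of i "real (Suc i) - a - b"]
    have "real (Suc i) * (real (Suc i) - a - b gchoose Suc i) = (real (Suc i) - a - b) * (real i - a - b gchoose i)"
      by (simp only:)
    hence "real (Suc i) * (real (Suc i) - a - b gchoose Suc i) * t ^ Suc i =
        (real (Suc i) - a - b) * (real i - a - b gchoose i) * t ^ Suc i" by simp
    thus ?thesis by (simp add: f_def mult_ac add_ac add_diff_eq)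
  qed
  have g: "real (i + 1) * g (i + 1) = (real i + a) * g i" for i
  proof -
    have rec: "real (Suc i) * (- a gchoose Suc i) = (- a - real i) * (- a gchoose i)"
      using gbinomial_absorption[of i "- a"] gbinomial_absorb_comp[of "- a" i] by simp
    have "real (i + 1) * g (i + 1) = - ((- 1) ^ i) * (real (Suc i) * (- a gchoose Suc i))"
      by (simp add: g_def)
    also have "\<dots> = (real i + a) * g i" unfolding rec by (simp add: g_def algebra_simps)
    finally show ?thesis .
  qed
  have "moment (\<lambda>u. u ^ j) = pi * h j"
  proof (induction j rule: induct_nat_012)
    case 0
    show ?case using moment_0 by (simp add: h_def f_def g_def)
  next
    case 1
    show ?case using moment_1 by (simp add: h_def f_def g_def algebra_simps)
  next
    case (ge2 j)
    have rec: "real (j + 2) * h (j + 2) =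
        (real (j + 1) * (1 + t) + (1 - a - b) * t + a) * h (j + 1) - (real j + (1 - a - b) + a) * t * h j"
      unfolding h_def by (rule convolution_recurrence[OF f g])
    have "real (j + 2) * moment (\<lambda>u. u ^ (j + 2)) = pi * (real (j + 2) * h (j + 2))"
      unfolding moment_recurrence rec using ge2 by (simp add: algebra_simps)
    hence "real (j + 2) * moment (\<lambda>u. u ^ (j + 2)) = real (j + 2) * (pi * h (j + 2))" by (simp only: mult_ac)
    hence "moment (\<lambda>u. u ^ (j + 2)) = pi * h (j + 2)" by (subst (asm) mult_cancel_left) simp
    thus ?case by simp
  qed
  thus ?thesis by (simp add: h_def f_def g_def)
qed

text \<open>Each factor \<open>1 - u\<close> multiplies the generating function by
  \<open>-(1 - z)\<close> while raising the index by one, so the exponent \<open>- a\<close> becomes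
  \<open>m - a\<close> and the sign is \<open>(- 1) ^ m\<close>. In the induction this is Pascal's
  rule after an index shift.\<close>

lemma moment_mixed:
  "moment (\<lambda>u. (1 - u) ^ m * u ^ j) =
     pi * (\<Sum>l\<le>m + j. (- 1) ^ (m + l) * (real m - a gchoose l) *
             ((real (m + j - l) - a - b gchoose (m + j - l)) * t ^ (m + j - l)))"
proof -
  define f where "f i = (real i - a - b gchoose i) * t ^ i" for i
  have "moment (\<lambda>u. (1 - u) ^ m * u ^ j) = pi * (\<Sum>l\<le>m + j. (- 1) ^ (m + l) * (real m - a gchoose l) * f (m + j - l))"
  proof (induction m arbitrary: j)
    case 0
    show ?case using moment_power[of j] by (simp add: f_def)
  next
    case (Suc m)
    let ?N = "m + j"
    let ?e = "\<lambda>l. (- 1) ^ (m + l) * (real m - a gchoose l)"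
    have "moment (\<lambda>u. (1 - u) ^ Suc m * u ^ j) = moment (\<lambda>u. (1 - u) ^ m * u ^ j - (1 - u) ^ m * u ^ Suc j)"
      by (simp add: algebra_simps)
    also have "\<dots> = moment (\<lambda>u. (1 - u) ^ m * u ^ j) - moment (\<lambda>u. (1 - u) ^ m * u ^ Suc j)"
      by (intro moment_diff continuous_intros)
    also have "\<dots> = pi * (\<Sum>l\<le>?N. ?e l * f (?N - l)) - pi * (\<Sum>l\<le>Suc ?N. ?e l * f (Suc ?N - l))"
      unfolding Suc.IH by simp
    also have "(\<Sum>l\<le>Suc ?N. ?e l * f (Suc ?N - l)) = ?e 0 * f (Suc ?N) + (\<Sum>l\<le>?N. ?e (Suc l) * f (?N - l))"
      by (subst sum.atMost_Suc_shift) simp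
    also have "pi * (\<Sum>l\<le>?N. ?e l * f (?N - l)) - pi * (?e 0 * f (Suc ?N) + (\<Sum>l\<le>?N. ?e (Suc l) * f (?N - l))) =
        pi * ((\<Sum>l\<le>?N. ?e l * f (?N - l) - ?e (Suc l) * f (?N - l)) - ?e 0 * f (Suc ?N))"
      by (simp only: sum_subtractf right_diff_distrib distrib_left diff_diff_eq add_ac)
    also have "(\<Sum>l\<le>?N. ?e l * f (?N - l) - ?e (Suc l) * f (?N - l)) =
        (\<Sum>l\<le>?N. (- 1) ^ (Suc m + Suc l) * (real (Suc m) - a gchoose Suc l) * f (?N - l))"
    proof (rule sum.cong[OF refl])
      fix l
      have "(real (Suc m) - a gchoose Suc l) = (real m - a gchoose l) + (real m - a gchoose Suc l)"
        using gbinomial_Suc_Suc[of "real m - a" l] by (simp add: algebra_simps)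
      thus "?e l * f (?N - l) - ?e (Suc l) * f (?N - l) =
          (- 1) ^ (Suc m + Suc l) * (real (Suc m) - a gchoose Suc l) * f (?N - l)"
        by (simp only:) (simp add: algebra_simps)
    qed
    also have "(\<Sum>l\<le>?N. (- 1) ^ (Suc m + Suc l) * (real (Suc m) - a gchoose Suc l) * f (?N - l)) - ?e 0 * f (Suc ?N) =
        (\<Sum>l\<le>Suc ?N. (- 1) ^ (Suc m + l) * (real (Suc m) - a gchoose l) * f (Suc ?N - l))"
      by (subst sum.atMost_Suc_shift) simp
    finally show ?case by simp
  qed
  thus ?thesis by (simp add: f_def)
qed

text \<open>All terms of the polynomial have total degree \<open>n\<close>, so their mixed moments
  share the factors \<open>f (n - l)\<close>. After exchanging the sums,
  \<open>gbinomial_mult_swap\<close> moves \<open>s\<close> out of the upper index and Vandermonde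
  sums over \<open>s\<close>. A second swap leaves the monomial form with exchanged
  parameters.\<close>

lemma moment_jacobiP:
  "moment (\<lambda>u. jacobiP (int n) (- a) (- b) (2 * u - 1)) =
     pi * (real n - a - b gchoose n) * jacobiP (int n) (- b) (- a) (2 * t - 1)"
proof -
  define f where "f i = (real i - a - b gchoose i) * t ^ i" for i
  let ?A = "real n - a" and ?B = "real n - b"
  have "moment (\<lambda>u. jacobiP (int n) (- a) (- b) (2 * u - 1)) =
      moment (\<lambda>u. \<Sum>s\<le>n. ((?A gchoose (n - s)) * (?B gchoose s) * (- 1) ^ s) * ((1 - u) ^ s * u ^ (n - s)))"
  proof -
    have "(u - 1) ^ s = (- 1) ^ s * (1 - u) ^ s" for u :: real and s
      by (simp flip: power_mult_distrib)
    thus ?thesis unfolding jacobiP_nat by (simp add: mult_ac)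
  qed
  also have "\<dots> = (\<Sum>s\<le>n. ((?A gchoose (n - s)) * (?B gchoose s) * (- 1) ^ s) * moment (\<lambda>u. (1 - u) ^ s * u ^ (n - s)))"
    by (subst moment_sum) (auto intro!: continuous_intros simp: moment_cmult)
  also have "\<dots> = (\<Sum>s\<le>n. \<Sum>l\<le>n. (pi * (- 1) ^ l * f (n - l)) *
      ((?A gchoose (n - s)) * (real s - a gchoose l) * (?B gchoose s)))"
  proof (rule sum.cong[OF refl])
    fix s assume "s \<in> {..n}"
    hence s: "s + (n - s) = n" by simp
    \<comment> \<open>The sign of \<open>(u - 1) ^ s\<close> cancels the one from the mixed moment,
      so what remains does not depend on \<open>s\<close>.\<close>
    have sgn: "(- 1) ^ s * (- 1) ^ (s + l) = (- 1 :: real) ^ l" for l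
      by (simp add: power_add flip: mult.assoc power_mult_distrib)
    have "moment (\<lambda>u. (1 - u) ^ s * u ^ (n - s)) = pi * (\<Sum>l\<le>n. (- 1) ^ (s + l) * (real s - a gchoose l) * f (n - l))"
      using moment_mixed[of s "n - s"] unfolding s f_def .
    hence "((?A gchoose (n - s)) * (?B gchoose s) * (- 1) ^ s) * moment (\<lambda>u. (1 - u) ^ s * u ^ (n - s)) =
       (\<Sum>l\<le>n. ((- 1) ^ s * (- 1) ^ (s + l)) * (pi * f (n - l) * (?A gchoose (n - s)) * (real s - a gchoose l) * (?B gchoose s)))"
      by (simp add: sum_distrib_left mult_ac)
    thus "((?A gchoose (n - s)) * (?B gchoose s) * (- 1) ^ s) * moment (\<lambda>u. (1 - u) ^ s * u ^ (n - s)) =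
       (\<Sum>l\<le>n. (pi * (- 1) ^ l * f (n - l)) * ((?A gchoose (n - s)) * (real s - a gchoose l) * (?B gchoose s)))"
      unfolding sgn by (simp add: mult_ac)
  qed
  also have "\<dots> = (\<Sum>l\<le>n. (pi * (- 1) ^ l * f (n - l)) *
      (\<Sum>s\<le>n. (?A gchoose (n - s)) * (real s - a gchoose l) * (?B gchoose s)))"
    by (subst sum.swap) (simp add: sum_distrib_left)
  also have "\<dots> = (\<Sum>l\<le>n. pi * (real n - a - b gchoose n) * ((- 1) ^ l * (real n + - a gchoose l) *
      (2 * real n - real l + - b + - a gchoose (n - l)) * t ^ (n - l)))"
  proof (rule sum.cong[OF refl])
    fix l assume l: "l \<in> {..n}"
    let ?r = "2 * real n - real l + - b + - a"
    have "(\<Sum>s\<le>n. (?A gchoose (n - s)) * (real s - a gchoose l) * (?B gchoose s)) =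
        (\<Sum>s\<le>n. (?A gchoose l) * ((?B gchoose s) * (?A - real l gchoose (n - s))))"
    proof (rule sum.cong[OF refl])
      fix s assume "s \<in> {..n}"
      hence "(?A gchoose (n - s)) * (real s - a gchoose l) = (?A gchoose l) * (?A - real l gchoose (n - s))"
        using gbinomial_mult_swap[of ?A "n - s" l] by (simp add: of_nat_diff)
      thus "(?A gchoose (n - s)) * (real s - a gchoose l) * (?B gchoose s) =
          (?A gchoose l) * ((?B gchoose s) * (?A - real l gchoose (n - s)))"
        by (simp only: mult_ac)
    qed
    also have "\<dots> = (?A gchoose l) * (\<Sum>s\<le>n. (?B gchoose s) * (?A - real l gchoose (n - s)))"
      by (simp add: sum_distrib_left)
    also have "(\<Sum>s\<le>n. (?B gchoose s) * (?A - real l gchoose (n - s))) = (?B + (?A - real l) gchoose n)"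
      using gbinomial_Vandermonde[of ?B "?A - real l" n] by (simp add: atMost_atLeast0)
    also have "?B + (?A - real l) = ?r" by simp
    finally have V: "(\<Sum>s\<le>n. (?A gchoose (n - s)) * (real s - a gchoose l) * (?B gchoose s)) = (?A gchoose l) * (?r gchoose n)" .
    have e: "?r - real n = real (n - l) - a - b" "?r - real (n - l) = real n - a - b"
      using l by (simp_all add: of_nat_diff)
    \<comment> \<open>This swap releases \<open>real n - a - b gchoose n\<close>, which is free of
      \<open>l\<close> and becomes the eigenvalue factor.\<close>
    have S: "(?r gchoose n) * (real (n - l) - a - b gchoose (n - l)) = (?r gchoose (n - l)) * (real n - a - b gchoose n)"
      using gbinomial_mult_swap[of ?r n "n - l"] unfolding e .
    have "(pi * (- 1) ^ l * f (n - l)) * ((?A gchoose l) * (?r gchoose n)) =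
       pi * (- 1) ^ l * t ^ (n - l) * (?A gchoose l) * ((?r gchoose n) * (real (n - l) - a - b gchoose (n - l)))"
      unfolding f_def by (simp only: mult_ac)
    also have "\<dots> = pi * (real n - a - b gchoose n) * ((- 1) ^ l * (?A gchoose l) * (?r gchoose (n - l)) * t ^ (n - l))"
      unfolding S by (simp only: mult_ac)
    finally show "(pi * (- 1) ^ l * f (n - l)) * (\<Sum>s\<le>n. (?A gchoose (n - s)) * (real s - a gchoose l) * (?B gchoose s)) =
      pi * (real n - a - b gchoose n) * ((- 1) ^ l * (real n + - a gchoose l) * (?r gchoose (n - l)) * t ^ (n - l))"
      unfolding V by simp
  qed
  also have "\<dots> = pi * (real n - a - b gchoose n) * jacobiP (int n) (- b) (- a) (2 * t - 1)"
    unfolding jacobiP_monomials sum_distrib_left ..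
  finally show ?thesis .
qed

end

section \<open>Return to Riemann-Liouville integrals on (-1,1)\<close>

lemma integral_affine_half:
  fixes f :: "real \<Rightarrow> real"
  shows "integral {c..d} f = 2 * integral {(c + 1) / 2..(d + 1) / 2} (\<lambda>u. f (2 * u - 1))"
proof -
  have iff: "((\<lambda>u. f (2 * u - 1)) has_integral I / 2) {(c + 1) / 2..(d + 1) / 2} \<longleftrightarrow> (f has_integral I) {c..d}" for I
    using has_integral_affinity_iff[of 2 f "-1" I c d] by (simp add: field_simps)
  show ?thesis
  proof (cases "f integrable_on {c..d}")
    case True
    hence "((\<lambda>u. f (2 * u - 1)) has_integral integral {c..d} f / 2) {(c + 1) / 2..(d + 1) / 2}"
      unfolding iff by (rule integrable_integral)
    thus ?thesis by (simp add: integral_unique)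
  next
    \<comment> \<open>Without integrability both integrals take the default value 0, so the equation
      persists.\<close>
    case False
    have "\<not> (\<lambda>u. f (2 * u - 1)) integrable_on {(c + 1) / 2..(d + 1) / 2}"
    proof
      assume "(\<lambda>u. f (2 * u - 1)) integrable_on {(c + 1) / 2..(d + 1) / 2}"
      then obtain I where "((\<lambda>u. f (2 * u - 1)) has_integral (2 * I) / 2) {(c + 1) / 2..(d + 1) / 2}"
        by (auto simp: integrable_on_def)
      with False show False unfolding iff by blast
    qed
    with False show ?thesis by (simp add: not_integrable_integral)
  qed
qed

text \<open>\<open>w\<close> stands for the distance of \<open>u\<close> from \<open>t\<close>. The
  powers of 2 from the three factors and the Jacobian 2 multiply to 1 precisely because
  \<open>\<sigma> + \<mu> + \<nu> = 0\<close>.\<close>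

lemma polyfrac_affine:
  assumes "0 \<le> u" "u \<le> 1" "0 \<le> w" "\<sigma> + \<mu> + \<nu> = 0"
  shows "2 * ((2 * w) powr (\<sigma> - 1) * polyfrac n \<mu> \<nu> (2 * u - 1)) =
    w powr (\<sigma> - 1) * u powr \<nu> * (1 - u) powr \<mu> * jacobiP (int n) \<mu> \<nu> (2 * u - 1)"
proof -
  have "2 powr (\<sigma> - 1) * 2 powr \<mu> * 2 powr \<nu> * 2 = (2 :: real) powr (\<sigma> - 1 + \<mu> + \<nu> + 1)"
    by (simp only: powr_add powr_one_gt_zero_iff) simp
  also have "\<sigma> - 1 + \<mu> + \<nu> + 1 = 0" using assms(4) by simp
  finally have two: "2 powr (\<sigma> - 1) * 2 powr \<mu> * 2 powr \<nu> * 2 = (1 :: real)" by simp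
  have "1 - (2 * u - 1) = 2 * (1 - u)" "1 + (2 * u - 1) = 2 * u" by simp_all
  hence "2 * ((2 * w) powr (\<sigma> - 1) * polyfrac n \<mu> \<nu> (2 * u - 1)) =
    2 * ((2 * w) powr (\<sigma> - 1) * ((2 * (1 - u)) powr \<mu> * (2 * u) powr \<nu> * jacobiP (int n) \<mu> \<nu> (2 * u - 1)))"
    unfolding polyfrac_def by (simp only:)
  also have "\<dots> = (2 powr (\<sigma> - 1) * 2 powr \<mu> * 2 powr \<nu> * 2) *
     (w powr (\<sigma> - 1) * u powr \<nu> * (1 - u) powr \<mu> * jacobiP (int n) \<mu> \<nu> (2 * u - 1))"
    using assms by (subst (1 2 3) powr_mult) (auto simp: mult_ac)
  finally show ?thesis unfolding two by simp
qed

lemma left_RL_int_polyfrac: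
  assumes "-1 < x" "x < 1" "\<sigma> + \<mu> + \<nu> = 0"
  shows "left_RL_int \<sigma> (polyfrac n \<mu> \<nu>) x =
    1 / Gamma \<sigma> * left_moment (- \<mu>) (- \<nu>) ((x + 1) / 2) (\<lambda>u. jacobiP (int n) \<mu> \<nu> (2 * u - 1))"
proof -
  have s: "- \<mu> + - \<nu> - 1 = \<sigma> - 1" using assms(3) by simp
  have "integral {-1..x} (\<lambda>y. (x - y) powr (\<sigma> - 1) * polyfrac n \<mu> \<nu> y) =
     integral {0..(x + 1) / 2} (\<lambda>u. 2 * ((x - (2 * u - 1)) powr (\<sigma> - 1) * polyfrac n \<mu> \<nu> (2 * u - 1)))"
    by (subst integral_affine_half) simp
  also have "\<dots> = left_moment (- \<mu>) (- \<nu>) ((x + 1) / 2) (\<lambda>u. jacobiP (int n) \<mu> \<nu> (2 * u - 1))"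
    unfolding left_moment_def s minus_minus
  proof (rule integral_cong)
    fix u assume u: "u \<in> {0..(x + 1) / 2}"
    have "x - (2 * u - 1) = 2 * ((x + 1) / 2 - u)" by (simp add: field_simps)
    hence "(x - (2 * u - 1)) powr (\<sigma> - 1) = (2 * ((x + 1) / 2 - u)) powr (\<sigma> - 1)" by (simp only:)
    thus "2 * ((x - (2 * u - 1)) powr (\<sigma> - 1) * polyfrac n \<mu> \<nu> (2 * u - 1)) =
      ((x + 1) / 2 - u) powr (\<sigma> - 1) * u powr \<nu> * (1 - u) powr \<mu> * jacobiP (int n) \<mu> \<nu> (2 * u - 1)"
      by (simp only:) (rule polyfrac_affine, use u assms in auto)
  qed
  finally show ?thesis by (simp add: left_RL_int_def)
qed

lemma right_RL_int_polyfrac: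
  assumes "-1 < x" "x < 1" "\<sigma> + \<mu> + \<nu> = 0"
  shows "right_RL_int \<sigma> (polyfrac n \<mu> \<nu>) x =
    1 / Gamma \<sigma> * right_moment (- \<mu>) (- \<nu>) ((x + 1) / 2) (\<lambda>u. jacobiP (int n) \<mu> \<nu> (2 * u - 1))"
proof -
  have s: "- \<mu> + - \<nu> - 1 = \<sigma> - 1" using assms(3) by simp
  have "integral {x..1} (\<lambda>y. (y - x) powr (\<sigma> - 1) * polyfrac n \<mu> \<nu> y) =
     integral {(x + 1) / 2..1} (\<lambda>u. 2 * ((2 * u - 1 - x) powr (\<sigma> - 1) * polyfrac n \<mu> \<nu> (2 * u - 1)))"
    by (subst integral_affine_half) simp
  also have "\<dots> = right_moment (- \<mu>) (- \<nu>) ((x + 1) / 2) (\<lambda>u. jacobiP (int n) \<mu> \<nu> (2 * u - 1))"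
    unfolding right_moment_def s minus_minus
  proof (rule integral_cong)
    fix u assume u: "u \<in> {(x + 1) / 2..1}"
    have "2 * u - 1 - x = 2 * (u - (x + 1) / 2)" by (simp add: field_simps)
    hence "(2 * u - 1 - x) powr (\<sigma> - 1) = (2 * (u - (x + 1) / 2)) powr (\<sigma> - 1)" by (simp only:)
    thus "2 * ((2 * u - 1 - x) powr (\<sigma> - 1) * polyfrac n \<mu> \<nu> (2 * u - 1)) =
      (u - (x + 1) / 2) powr (\<sigma> - 1) * u powr \<nu> * (1 - u) powr \<mu> * jacobiP (int n) \<mu> \<nu> (2 * u - 1)"
      by (simp only:) (rule polyfrac_affine, use u assms in auto)
  qed
  finally show ?thesis by (simp add: right_RL_int_def)
qed

section \<open>The two-sided integral and its derivatives\<close>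

lemma two_sided_int_polyfrac:
  fixes p \<alpha> \<mu> \<nu> :: real
  assumes "1 < \<alpha>" "\<alpha> < 2" "\<mu> \<le> 0" "\<nu> \<le> 0" and sum: "\<mu> + \<nu> = \<alpha> - 2"
    and p: "p * sin (pi * \<mu>) = (1 - p) * sin (pi * \<nu>)" and x: "-1 < x" "x < 1"
  shows "two_sided_int p \<alpha> \<mu> \<nu> (2 - \<alpha>) (polyfrac n \<mu> \<nu>) x =
    Gamma (real n + \<alpha> - 1) / Gamma (real n + 1) * jacobiP (int n) \<nu> \<mu> x"
proof -
  define t where "t = (x + 1) / 2"
  interpret frac_exponents "- \<mu>" "- \<nu>" t
    using assms by unfold_locales (auto simp: t_def)
  let ?q = "\<lambda>u. jacobiP (int n) \<mu> \<nu> (2 * u - 1)"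
  let ?L = "left_moment (- \<mu>) (- \<nu>) t ?q" and ?R = "right_moment (- \<mu>) (- \<nu>) t ?q"
  define S where "S = sin (pi * (2 - \<alpha>))"
  \<comment> \<open>The minus sign later cancels against the one from passing to
    \<open>- \<mu>\<close> and \<open>- \<nu>\<close> in the sine weights of
    \<open>moment\<close>.\<close>
  have S\<alpha>: "sin (pi * \<alpha>) = - S"
    by (simp add: S_def right_diff_distrib sin_diff)
  have "S > 0" unfolding S_def using assms by (intro sin_gt_zero) auto
  have ps: "p * (sin (pi * \<mu>) + sin (pi * \<nu>)) = sin (pi * \<nu>)"
    "(1 - p) * (sin (pi * \<mu>) + sin (pi * \<nu>)) = sin (pi * \<mu>)"
    using p by (simp_all add: algebra_simps)
  have "2 - \<alpha> + \<mu> + \<nu> = 0" using sum by simp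
  hence "two_sided_int p \<alpha> \<mu> \<nu> (2 - \<alpha>) (polyfrac n \<mu> \<nu>) x =
     - (p * (sin (pi * \<mu>) + sin (pi * \<nu>)) * ?L + (1 - p) * (sin (pi * \<mu>) + sin (pi * \<nu>)) * ?R) / (S * Gamma (2 - \<alpha>))"
    unfolding two_sided_int_def C_const_def S\<alpha> t_def
    using x by (simp add: left_RL_int_polyfrac right_RL_int_polyfrac) (simp add: add_divide_distrib diff_divide_distrib algebra_simps)
  also have "\<dots> = moment ?q / (S * Gamma (2 - \<alpha>))"
    unfolding ps moment_def by simp
  also have "moment ?q = pi * (real n - (2 - \<alpha>) gchoose n) * jacobiP (int n) \<nu> \<mu> x"
  proof -
    have "2 * t - 1 = x" by (simp add: t_def field_simps)
    moreover have "real n - - \<mu> - - \<nu> = real n - (2 - \<alpha>)" using sum by simp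
    ultimately show ?thesis using moment_jacobiP[of n] by (simp only: minus_minus)
  qed
  \<comment> \<open>The binomial coefficient is
    \<open>pochhammer (\<alpha> - 1) n / fact n\<close>.\<close>
  also have "real n - (2 - \<alpha>) gchoose n = Gamma (real n + \<alpha> - 1) / (Gamma (\<alpha> - 1) * fact n)"
  proof -
    have "\<alpha> - 1 \<notin> \<int>\<^sub>\<le>\<^sub>0" using assms by (auto elim!: nonpos_Ints_cases)
    hence "pochhammer (\<alpha> - 1) n = Gamma (real n + \<alpha> - 1) / Gamma (\<alpha> - 1)"
      using pochhammer_Gamma[of "\<alpha> - 1" n] by (simp add: algebra_simps)
    thus ?thesis
      unfolding gbinomial_pochhammer' by simp
  qed
  also have "pi * (Gamma (real n + \<alpha> - 1) / (Gamma (\<alpha> - 1) * fact n)) * jacobiP (int n) \<nu> \<mu> x / (S * Gamma (2 - \<alpha>)) =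
     (pi / (S * (Gamma (2 - \<alpha>) * Gamma (\<alpha> - 1)))) * (Gamma (real n + \<alpha> - 1) / fact n * jacobiP (int n) \<nu> \<mu> x)"
    by (simp add: field_simps)
  \<comment> \<open>Reflection at \<open>2 - \<alpha>\<close> cancels the remaining
    \<open>pi\<close> and sine.\<close>
  also have "Gamma (2 - \<alpha>) * Gamma (\<alpha> - 1) = pi / S"
    using Gamma_reflection_real[of "2 - \<alpha>"] by (simp add: S_def)
  also have "pi / (S * (pi / S)) = 1" using \<open>S > 0\<close> by simp
  finally show ?thesis
    using Gamma_fact[of n, where ?'a = real] by (simp add: add.commute)
qed

theorem theorem2p2:
  fixes p \<alpha> \<mu> \<nu> :: real
  assumes "0 \<le> p" "p \<le> 1" "1 < \<alpha>" "\<alpha> < 2"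
    and "\<alpha> - 2 \<le> \<mu>" "\<mu> \<le> 0" "\<alpha> - 2 \<le> \<nu>" "\<nu> \<le> 0"
    and "\<mu> + \<nu> = \<alpha> - 2"
    and "p * sin (pi * \<mu>) = (1 - p) * sin (pi * \<nu>)"
  shows "\<forall>x \<in> {-1<..<1}. \<forall>n::nat.
           two_sided_int p \<alpha> \<mu> \<nu> (2 - \<alpha>) (polyfrac n \<mu> \<nu>) x
             = Gamma (real n + \<alpha> - 1) / Gamma (real n + 1) * jacobiP (int n) \<nu> \<mu> x
         \<and> (\<forall>k::nat. 1 \<le> k \<longrightarrow>
              two_sided_deriv p \<alpha> \<mu> \<nu> (real k + \<alpha> - 2) (polyfrac n \<mu> \<nu>) x
                = Gamma (real n + real k + \<alpha> - 1) / (2 ^ k * Gamma (real n + 1))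
                  * jacobiP (int n - int k) (\<nu> + real k) (\<mu> + real k) x)"
proof (intro ballI allI conjI impI)
  fix x :: real and n :: nat
  assume x: "x \<in> {-1<..<1}"
  have int_eq: "two_sided_int p \<alpha> \<mu> \<nu> (2 - \<alpha>) (polyfrac n \<mu> \<nu>) y
      = Gamma (real n + \<alpha> - 1) / Gamma (real n + 1) * jacobiP (int n) \<nu> \<mu> y" if "y \<in> {-1<..<1}" for y
    using that assms by (intro two_sided_int_polyfrac) auto
  show "two_sided_int p \<alpha> \<mu> \<nu> (2 - \<alpha>) (polyfrac n \<mu> \<nu>) x
      = Gamma (real n + \<alpha> - 1) / Gamma (real n + 1) * jacobiP (int n) \<nu> \<mu> x"
    using x by (rule int_eq)
  fix k :: nat
  assume "1 \<le> k"
  \<comment> \<open>As \<open>\<alpha> - 2\<close> lies strictly between -1 and 0, exactly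
    \<open>k\<close> derivatives are taken, and the order of the inner integral is
    \<open>2 - \<alpha>\<close> for every \<open>k\<close>.\<close>
  have "\<lceil>real k + \<alpha> - 2\<rceil> = int k"
    using assms by (intro ceiling_unique) auto
  hence "two_sided_deriv p \<alpha> \<mu> \<nu> (real k + \<alpha> - 2) (polyfrac n \<mu> \<nu>) x =
      (deriv ^^ k) (two_sided_int p \<alpha> \<mu> \<nu> (2 - \<alpha>) (polyfrac n \<mu> \<nu>)) x"
    by (simp add: two_sided_deriv_def)
  also have "\<dots> = Gamma (real n + real k + \<nu> + \<mu> + 1) / 2 ^ k * (1 / Gamma (real n + 1)) *
      jacobiP (int n - int k) (\<nu> + real k) (\<mu> + real k) x"
  proof (rule higher_deriv_jacobiP[where S = "{-1<..<1}"])
    have e: "real n + \<nu> + \<mu> + 1 = real n + \<alpha> - 1" using assms by simp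
    show "two_sided_int p \<alpha> \<mu> \<nu> (2 - \<alpha>) (polyfrac n \<mu> \<nu>) y =
        Gamma (real n + \<nu> + \<mu> + 1) * (1 / Gamma (real n + 1)) * jacobiP (int n) \<nu> \<mu> y" if "y \<in> {-1<..<1}" for y
      unfolding e using int_eq[OF that] by simp
  qed (use x assms in auto)
  also have "real n + real k + \<nu> + \<mu> + 1 = real n + real k + \<alpha> - 1" using assms by simp
  finally show "two_sided_deriv p \<alpha> \<mu> \<nu> (real k + \<alpha> - 2) (polyfrac n \<mu> \<nu>) x
      = Gamma (real n + real k + \<alpha> - 1) / (2 ^ k * Gamma (real n + 1))
        * jacobiP (int n - int k) (\<nu> + real k) (\<mu> + real k) x"
    by simp
qed

end
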